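(* Let $H$ be a complex Hilbert space and let $A \in B(H)$. Consider the following conditions. (A1) $A$ is a (scalar) multiple of a positive semi-definite operator. (A2) $\sigma(AB) \subseteq \overline{W(A)W(B)}$ for all $B \in B(H)$. (A3) $\sigma(AB) \subseteq \overline{W(A)W(B)}$ for all rank one $B \in B(H)$. In each of the following cases, conditions (A1), (A2), (A3) are equivalent. (1) $\overline{W(A)}$ is a convex polygon, which may degenerate to a line segment or a point. (This covers the cases when $A$ is a scalar multiple of a hermitian operator, or when $A$ is a normal operator with finite spectrum.) (2) $A$ is normal and there is an isolated point $\lambda$ of $\sigma(A)$ attaining the spectral radius, i.e. $|\lambda|=r(A)$.
   Context: $B(H)$ is the algebra of bounded linear operators on a complex Hilbert space $H$ (of finite or infinite dimension). For $A\in B(H)$, $\sigma(A)=\{\lambda\in\mathbb{C}: A-\lambda I \text{ is not invertible}\}$ is the spectrum, $r(A)=\max\{|z|: z\in\sigma(A)\}$ is the spectral radius, and $W(A)=\{\langle Ax,x\rangle : x\in H,\ \|x\|=1\}$ is the numerical range. For sets $S,T\subseteq\mathbb{C}$, $ST=\{st: s\in S,\ t\in T\}$, and $\overline{S}$ denotes the closure of $S$. "A multiple of a positive semi-definite operator" means an operator of the form $\gamma P$ with $\gamma\in\mathbb{C}$ and $P\in B(H)$ positive semi-definite. A (possibly degenerate) convex polygon is the convex hull of a nonempty finite set of points in $\mathbb{C}$. *)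

theory Defs
  imports "HOL-Analysis.Analysis"
begin

section \<open>Complex Hilbert spaces\<close>

class complex_vector = real_vector +
  fixes scaleC :: "complex \<Rightarrow> 'a \<Rightarrow> 'a"  (infixr \<open>*\<^sub>C\<close> 75)
  assumes scaleC_right_distrib: "c *\<^sub>C (x + y) = c *\<^sub>C x + c *\<^sub>C y"
    and scaleC_left_distrib: "(c + d) *\<^sub>C x = c *\<^sub>C x + d *\<^sub>C x"
    and scaleC_scaleC: "c *\<^sub>C (d *\<^sub>C x) = (c * d) *\<^sub>C x"
    and scaleC_one: "1 *\<^sub>C x = x"
    and scaleC_of_real: "complex_of_real r *\<^sub>C x = r *\<^sub>R x"

global_interpretation complex_vector:
  vector_space "scaleC :: complex \<Rightarrow> 'a \<Rightarrow> 'a :: complex_vector"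
  by standard (fact scaleC_right_distrib scaleC_left_distrib scaleC_scaleC scaleC_one)+

text \<open>
  The superclass \<^class>\<open>real_inner\<close> imposes no restriction: its inner product is determined by
  the complex one (last axiom), and it makes the norm satisfy \<open>\<parallel>x\<parallel>\<^sup>2 = Re \<langle>x, x\<rangle> = \<langle>x, x\<rangle>\<close>
  and \<open>\<langle>x, x\<rangle>\<close> positive definite. The complex inner product is linear in the first argument.
\<close>

class complex_hilbert = complex_vector + real_inner + complete_space +
  fixes cinner :: "'a \<Rightarrow> 'a \<Rightarrow> complex"
  assumes cinner_commute: "cinner x y = cnj (cinner y x)"
    and cinner_add_left: "cinner (x + y) z = cinner x z + cinner y z"
    and cinner_scaleC_left: "cinner (c *\<^sub>C x) y = c * cinner x y"
    and inner_eq_Re_cinner: "inner x y = Re (cinner x y)"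

instantiation complex :: complex_hilbert
begin

definition scaleC_complex :: "complex \<Rightarrow> complex \<Rightarrow> complex"
  where "scaleC_complex c z = c * z"

definition cinner_complex :: "complex \<Rightarrow> complex \<Rightarrow> complex"
  where "cinner_complex z w = z * cnj w"

instance
  by standard
    (simp_all add: scaleC_complex_def cinner_complex_def algebra_simps scaleR_conv_of_real
      inner_complex_def)

end


section \<open>Bounded operators\<close>

definition bounded_op :: "('a::complex_hilbert \<Rightarrow> 'a) \<Rightarrow> bool" where
  "bounded_op A \<longleftrightarrow>
     Vector_Spaces.linear scaleC scaleC A \<and> (\<exists>K. \<forall>x. norm (A x) \<le> K * norm x)"

definition invertible_op :: "('a::complex_hilbert \<Rightarrow> 'a) \<Rightarrow> bool" where
  "invertible_op A \<longleftrightarrow> bounded_op A \<and> (\<exists>B. bounded_op B \<and> A \<circ> B = id \<and> B \<circ> A = id)"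

definition spectrum :: "('a::complex_hilbert \<Rightarrow> 'a) \<Rightarrow> complex set" where
  "spectrum A = {z. \<not> invertible_op (\<lambda>x. A x - z *\<^sub>C x)}"

text \<open>
  On a nonzero space the spectrum of a bounded operator is nonempty and compact, so the supremum
  is a maximum.
\<close>

definition spectral_radius :: "('a::complex_hilbert \<Rightarrow> 'a) \<Rightarrow> real" where
  "spectral_radius A = Sup (cmod ` spectrum A)"

definition numerical_range :: "('a::complex_hilbert \<Rightarrow> 'a) \<Rightarrow> complex set" where
  "numerical_range A = {cinner (A x) x | x. norm x = 1}"

text \<open>For a bounded operator the adjoint exists and is unique (Riesz).\<close>

definition cadjoint :: "('a::complex_hilbert \<Rightarrow> 'a) \<Rightarrow> 'a \<Rightarrow> 'a" where
  "cadjoint A = (THE B. \<forall>x y. cinner (A x) y = cinner x (B y))"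

definition normal_op :: "('a::complex_hilbert \<Rightarrow> 'a) \<Rightarrow> bool" where
  "normal_op A \<longleftrightarrow> bounded_op A \<and> cadjoint A \<circ> A = A \<circ> cadjoint A"

definition hermitian_op :: "('a::complex_hilbert \<Rightarrow> 'a) \<Rightarrow> bool" where
  "hermitian_op A \<longleftrightarrow> bounded_op A \<and> cadjoint A = A"

definition psd_op :: "('a::complex_hilbert \<Rightarrow> 'a) \<Rightarrow> bool" where
  "psd_op P \<longleftrightarrow> bounded_op P \<and> (\<forall>x. cinner (P x) x \<in> \<real>\<^sub>\<ge>\<^sub>0)"

definition rank_one_op :: "('a::complex_hilbert \<Rightarrow> 'a) \<Rightarrow> bool" where
  "rank_one_op B \<longleftrightarrow> bounded_op B \<and> complex_vector.dim (range B) = 1"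


section \<open>Convex polygons\<close>

text \<open>Unlike \<^const>\<open>polytope\<close>, this excludes the empty set.\<close>

definition convex_polygon :: "complex set \<Rightarrow> bool" where
  "convex_polygon S \<longleftrightarrow> (\<exists>F. finite F \<and> F \<noteq> {} \<and> S = convex hull F)"

end

theory Submission
  imports Defs
begin

text \<open>
  If \<open>P\<close> is positive and \<open>P B x \<approx> \<lambda> x\<close> with \<open>\<lambda> \<noteq> 0\<close>, then with \<open>y = B x\<close> the number \<open>\<lambda>\<close> is nearly the product of
  \<open>\<langle>B x, x\<rangle>\<close> and \<open>\<parallel>P y\<parallel>\<^sup>2 / \<langle>P y, y\<rangle>\<close>, and the latter lies in \<open>W(P)\<close>.

  Conversely, rescale so that \<open>1\<close> is a point of maximal modulus of a set \<open>S\<close> of approximate eigenvalues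
  (with nearly reducing eigenvectors) whose convex hull contains \<open>W(A)\<close>, namely the vertices of the
  polygon or the spectrum of \<open>A\<close>. Let \<open>e\<close>, \<open>v\<close> be eigenvectors for \<open>1\<close> and \<open>\<mu> \<in> S\<close>. Testing the inclusion on
  the rank one operators built from small perturbations \<open>e + s v\<close> and \<open>e + s' v\<close>, whose numerical ranges are
  thin ellipses, gives \<open>Re \<mu> + t Im \<mu> \<le> 1 - \<bar>\<mu> - 1\<bar>\<^sup>2\<close> whenever the functional \<open>Re + t Im\<close> attains its maximum
  on \<open>S\<close> only at \<open>1\<close>. As \<open>1\<close> is isolated in \<open>S\<close>, this improvement makes the set of admissible \<open>t\<close> both open
  and closed, so every \<open>t\<close> is admissible, and then \<open>S \<subseteq> [0, 1]\<close>.
\<close>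

section \<open>Inner products and bounded operators\<close>

text \<open>The rank one test is a competition between two orders of magnitude. With x = e + s v, y
  = e + t v, s = sqrt \<open>\<epsilon>\<close> and s \<open>cnj t\<close> =
  \<open>\<epsilon>\<close> \<open>\<zeta>\<close>, the thin ellipse has foci 0 and nearly 1 +
  \<open>\<epsilon>\<close> \<open>\<zeta>\<close>, and its squared minor axis is nearly 2
  \<open>\<epsilon>\<close> (1 - Re \<open>\<zeta>\<close>). At the point 1 of S the ellipse sticks
  out beyond its focus by O(\<open>\<epsilon>\<close>) only, the order at which \<open>\<mu>\<close>
  shows in the tested value 1 + \<open>\<epsilon>\<close> \<open>\<zeta>\<close>
  \<open>\<mu>\<close>. The other points of S are controlled only up to O(sqrt
  \<open>\<epsilon>\<close>), so the functional must separate them from 1 by a gap independent of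
  \<open>\<epsilon>\<close>; isolation of 1 supplies it. Comparing first order terms over all phases
  \<open>\<zeta>\<close> then confines \<open>\<mu>\<close> to a disc. Eigenvectors need not exist,
  so limits along approximate ones are taken. They have to be approximate eigenvectors of the
  adjoint too, since both cross terms between e and v must vanish. For normal operators this is
  automatic; at a vertex of a polygon it follows because the numerical range lies in a sector
  there.\<close>

lemma cinner_add_right: "cinner x (y + z) = cinner x y + cinner x z"
  by (metis cinner_add_left cinner_commute complex_cnj_add)

lemma cinner_scaleC_right: "cinner x (c *\<^sub>C y) = cnj c * cinner x y"
  by (metis cinner_commute cinner_scaleC_left complex_cnj_mult)

lemma cinner_scaleR_left: "cinner (r *\<^sub>R x) y = of_real r * cinner x y"
  by (metis cinner_scaleC_left scaleC_of_real)

lemma cinner_scaleR_right: "cinner x (r *\<^sub>R y) = of_real r * cinner x y"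
  by (metis cinner_scaleC_right complex_cnj_complex_of_real scaleC_of_real)

lemma cinner_minus_left: "cinner (- x) y = - cinner x y"
  using cinner_scaleR_left[of "-1" x y] by simp

lemma cinner_minus_right: "cinner x (- y) = - cinner x y"
  using cinner_scaleR_right[of x "-1" y] by simp

lemma cinner_diff_left: "cinner (x - y) z = cinner x z - cinner y z"
  by (metis ab_group_add_class.ab_diff_conv_add_uminus cinner_add_left cinner_minus_left)

lemma cinner_diff_right: "cinner x (y - z) = cinner x y - cinner x z"
  by (metis ab_group_add_class.ab_diff_conv_add_uminus cinner_add_right cinner_minus_right)

lemma cinner_zero_left [simp]: "cinner 0 y = 0"
  using cinner_scaleR_left[of 0 0 y] by simp

lemma cinner_zero_right [simp]: "cinner x 0 = 0"
  using cinner_scaleR_right[of x 0 0] by simp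

lemmas cinner_simps = cinner_add_left cinner_add_right cinner_diff_left cinner_diff_right
  cinner_scaleC_left cinner_scaleC_right cinner_scaleR_left cinner_scaleR_right
  cinner_minus_left cinner_minus_right

lemma cinner_self: "cinner x x = of_real ((norm x)\<^sup>2)"
proof (rule complex_eqI)
  show "Re (cinner x x) = Re (of_real ((norm x)\<^sup>2))"
    by (simp add: inner_eq_Re_cinner[symmetric] power2_norm_eq_inner)
  have "cnj (cinner x x) = cinner x x"
    using cinner_commute[of x x] by simp
  then show "Im (cinner x x) = Im (of_real ((norm x)\<^sup>2))"
    by (simp add: complex_eq_iff)
qed

lemma norm_scaleC: "norm (c *\<^sub>C x) = cmod c * norm (x::'a::complex_hilbert)"
proof -
  have "complex_of_real ((norm (c *\<^sub>C x))\<^sup>2) = c * cnj c * of_real ((norm x)\<^sup>2)"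
    by (simp only: cinner_self[symmetric] cinner_simps mult_ac)
  also have "\<dots> = of_real ((cmod c * norm x)\<^sup>2)"
    by (simp add: complex_norm_square[symmetric] power_mult_distrib)
  finally have "(norm (c *\<^sub>C x))\<^sup>2 = (cmod c * norm x)\<^sup>2"
    by (simp only: of_real_eq_iff)
  then show ?thesis
    by (simp add: power2_eq_iff_nonneg)
qed

text \<open>Serves to turn a modulus into a real part, so that estimates for the real inner product
  carry over to the complex one; it also picks optimal phases later on.\<close>

lemma unit_phase:
  obtains w where "cmod w = 1" "w * z = of_real (cmod z)"
proof (cases "z = 0")
  case True
  then show ?thesis using that[of 1] by simp
next
  case False
  show ?thesis
  proof (rule that[of "cnj z / of_real (cmod z)"])
    show "cmod (cnj z / complex_of_real (cmod z)) = 1"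
      using False by (simp add: norm_divide)
    have "cnj z * z = of_real (cmod z) * of_real (cmod z)"
      by (metis complex_norm_square mult.commute of_real_mult power2_eq_square)
    then show "cnj z / complex_of_real (cmod z) * z = complex_of_real (cmod z)"
      using False by (simp add: field_simps)
  qed
qed

lemma norm_cinner_le: "cmod (cinner x y) \<le> norm x * norm (y::'a::complex_hilbert)"
proof -
  obtain w where w: "cmod w = 1" "w * cinner x y = of_real (cmod (cinner x y))"
    by (rule unit_phase)
  have "cmod (cinner x y) = inner (w *\<^sub>C x) y"
    by (simp add: inner_eq_Re_cinner cinner_simps w)
  also have "\<dots> \<le> norm (w *\<^sub>C x) * norm y"
    by (rule norm_cauchy_schwarz)
  finally show ?thesis by (simp add: norm_scaleC w)
qed

lemma scaleC_simps [simp]: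
  fixes x :: "'a::complex_hilbert"
  shows "0 *\<^sub>C x = 0" "1 *\<^sub>C x = x" "c *\<^sub>C (0::'a) = 0"
  using norm_scaleC[of 0 x] norm_scaleC[of c "0::'a"] by (simp_all add: scaleC_one)

lemma bounded_opI:
  fixes A :: "'a::complex_hilbert \<Rightarrow> 'a"
  assumes "\<And>x y. A (x + y) = A x + A y" "\<And>c x. A (c *\<^sub>C x) = c *\<^sub>C A x"
    and "\<And>x. norm (A x) \<le> K * norm x"
  shows "bounded_op A"
  unfolding bounded_op_def using assms
  by (auto intro!: Vector_Spaces.linear.intro module_hom.intro module_hom_axioms.intro
      complex_vector.module_axioms complex_vector.vector_space_axioms)

lemma bounded_op_add: "bounded_op A \<Longrightarrow> A (x + y) = A x + A y"
  unfolding bounded_op_def by (metis module_hom.add module_hom_iff_linear)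

lemma bounded_op_scaleC: "bounded_op A \<Longrightarrow> A (c *\<^sub>C x) = c *\<^sub>C A x"
  unfolding bounded_op_def by (metis module_hom.scale module_hom_iff_linear)

lemma bounded_op_scaleR: "bounded_op A \<Longrightarrow> A (r *\<^sub>R x) = r *\<^sub>R A x"
  by (metis bounded_op_scaleC scaleC_of_real)

lemma bounded_op_zero [simp]: "bounded_op A \<Longrightarrow> A 0 = 0"
  using bounded_op_scaleR[of A 0 0] by simp

lemma bounded_op_minus: "bounded_op A \<Longrightarrow> A (- x) = - A x"
  using bounded_op_scaleR[of A "-1" x] by simp

lemma bounded_op_diff: "bounded_op A \<Longrightarrow> A (x - y) = A x - A y"
  by (metis ab_group_add_class.ab_diff_conv_add_uminus bounded_op_add bounded_op_minus)

lemmas bounded_op_simps = bounded_op_add bounded_op_scaleC bounded_op_scaleR bounded_op_minus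
  bounded_op_diff

lemma bounded_op_bound:
  assumes "bounded_op A"
  obtains K where "K > 0" "\<And>x. norm (A x) \<le> K * norm x"
proof -
  obtain K where K: "\<And>x. norm (A x) \<le> K * norm x"
    using assms unfolding bounded_op_def by auto
  have "norm (A x) \<le> (\<bar>K\<bar> + 1) * norm x" for x
    by (rule order_trans[OF K mult_right_mono]) auto
  then show ?thesis using that[of "\<bar>K\<bar> + 1"] by auto
qed

lemma bounded_op_scale:
  assumes "bounded_op A"
  shows "bounded_op (\<lambda>x. c *\<^sub>C A x)"
proof -
  obtain K where K: "K > 0" "\<And>x. norm (A x) \<le> K * norm x"
    using bounded_op_bound[OF assms] by blast
  have "norm (c *\<^sub>C A x) \<le> cmod c * K * norm x" for x
    using mult_left_mono[OF K(2)[of x], of "cmod c"] by (simp add: norm_scaleC mult.assoc)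
  then show ?thesis
    using assms
    by (intro bounded_opI[of _ "cmod c * K"])
      (auto simp: bounded_op_simps scaleC_right_distrib scaleC_scaleC mult_ac)
qed

lemma bounded_op_plus:
  assumes "bounded_op A" "bounded_op B"
  shows "bounded_op (\<lambda>x. A x + B x)"
proof -
  obtain K where K: "\<And>x. norm (A x) \<le> K * norm x"
    using bounded_op_bound[OF assms(1)] by blast
  obtain L where L: "\<And>x. norm (B x) \<le> L * norm x"
    using bounded_op_bound[OF assms(2)] by blast
  have "norm (A x + B x) \<le> (K + L) * norm x" for x
    using norm_triangle_ineq[of "A x" "B x"] K[of x] L[of x] by (simp add: algebra_simps)
  then show ?thesis
    using assms by (intro bounded_opI[of _ "K + L"]) (auto simp: bounded_op_simps scaleC_right_distrib)
qed

lemma bounded_op_id: "bounded_op (\<lambda>x. x)"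
  by (rule bounded_opI[of _ 1]) auto

lemma scaleC_minus_left: "(- c) *\<^sub>C x = - (c *\<^sub>C (x::'a::complex_hilbert))"
proof -
  have "(- c) *\<^sub>C x + c *\<^sub>C x = 0"
    by (simp add: scaleC_left_distrib[symmetric])
  then show ?thesis by (simp add: eq_neg_iff_add_eq_0)
qed

lemma scaleC_diff_left: "(c - d) *\<^sub>C x = c *\<^sub>C x - d *\<^sub>C (x::'a::complex_hilbert)"
  using scaleC_left_distrib[of c "-d" x] by (simp add: scaleC_minus_left)

lemma scaleC_diff_right: "c *\<^sub>C (x - y) = c *\<^sub>C x - c *\<^sub>C (y::'a::complex_hilbert)"
  using scaleC_right_distrib[of c "x - y" y] by (simp add: eq_diff_eq)

lemma bounded_op_shift:
  assumes "bounded_op A"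
  shows "bounded_op (\<lambda>x. A x - z *\<^sub>C x)"
  using bounded_op_plus[OF assms bounded_op_scale[OF bounded_op_id, of "-z"]]
  by (simp add: scaleC_minus_left)

lemma bounded_op_comp:
  assumes "bounded_op A" "bounded_op B"
  shows "bounded_op (A \<circ> B)"
proof -
  obtain K where K: "K > 0" "\<And>x. norm (A x) \<le> K * norm x"
    using bounded_op_bound[OF assms(1)] by blast
  obtain L where L: "\<And>x. norm (B x) \<le> L * norm x"
    using bounded_op_bound[OF assms(2)] by blast
  have "norm (A (B x)) \<le> (K * L) * norm x" for x
    using order_trans[OF K(2)[of "B x"] mult_left_mono[OF L[of x], of K]] K(1)
    by (simp add: mult.assoc)
  then show ?thesis
    using assms by (intro bounded_opI[of _ "K * L"]) (auto simp: bounded_op_simps)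
qed

lemma bounded_op_imp_bounded_linear:
  assumes "bounded_op A"
  shows "bounded_linear A"
proof -
  obtain K where "\<And>x. norm (A x) \<le> K * norm x"
    using bounded_op_bound[OF assms] by blast
  then show ?thesis
    using assms by (intro bounded_linear_intro[of _ K]) (auto simp: bounded_op_simps mult.commute)
qed

section \<open>Orthogonality and the adjoint\<close>

text \<open>Projection theorem: a minimising sequence for the distance from \<open>p\<close> to
  \<open>M\<close> is Cauchy, and \<open>p\<close> minus its limit is orthogonal to
  \<open>M\<close>.\<close>

lemma orthogonal_to_closed_subspace:
  fixes M :: "'a::{real_inner, complete_space} set"
  assumes M: "subspace M" "closed M" and p: "p \<notin> M"
  obtains w where "w \<noteq> 0" "\<And>m. m \<in> M \<Longrightarrow> inner m w = 0"
proof -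
  define d where "d = infdist p M"
  have ne: "M \<noteq> {}" using subspace_0[OF M(1)] by auto
  have low: "d \<le> norm (p - m)" if "m \<in> M" for m
    using infdist_le[OF that, of p] by (simp add: d_def dist_norm)
  have d0: "d \<ge> 0" by (simp add: d_def infdist_nonneg)
  have "\<exists>m\<in>M. norm (p - m) < d + 1 / real (Suc n)" for n
  proof -
    have "infdist p M < d + 1 / real (Suc n)" by (simp add: d_def)
    then show ?thesis
      using ne cINF_less_iff[OF ne bdd_belowI2[of M 0 "dist p"]]
      by (simp add: infdist_notempty dist_norm)
  qed
  then obtain m where mM: "\<And>n. m n \<in> M" and mn: "\<And>n. norm (p - m n) < d + 1 / real (Suc n)"
    by metis
  have lim: "(\<lambda>n. norm (p - m n)) \<longlonglongrightarrow> d"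
  proof (rule tendsto_sandwich[of "\<lambda>n. d" _ _ "\<lambda>n. d + 1 / real (Suc n)"])
    show "(\<lambda>n. d + 1 / real (Suc n)) \<longlonglongrightarrow> d"
      using tendsto_add[OF tendsto_const LIMSEQ_inverse_real_of_nat, of d]
      by (simp add: inverse_eq_divide)
  qed (use low mM less_imp_le[OF mn] in \<open>auto simp del: of_nat_Suc\<close>)
  \<comment> \<open>Parallelogram law, using that the midpoint of \<open>m i\<close> and
    \<open>m j\<close> lies in \<open>M\<close> and so is at distance at least \<open>d\<close> from
    \<open>p\<close>.\<close>
  have par: "(norm (m i - m j))\<^sup>2 \<le> 2 * (norm (p - m i))\<^sup>2 + 2 * (norm (p - m j))\<^sup>2 - 4 * d\<^sup>2" for i j
  proof -
    have "(1/2) *\<^sub>R (m i + m j) \<in> M"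
      by (intro subspace_scale subspace_add M mM)
    from low[OF this] have "d\<^sup>2 \<le> (norm (p - (1/2) *\<^sub>R (m i + m j)))\<^sup>2"
      using d0 by (intro power_mono)
    moreover have "4 * (norm (p - (1/2) *\<^sub>R (m i + m j)))\<^sup>2 + (norm (m i - m j))\<^sup>2
        = 2 * (norm (p - m i))\<^sup>2 + 2 * (norm (p - m j))\<^sup>2"
      by (simp add: power2_norm_eq_inner inner_simps inner_commute algebra_simps)
    ultimately show ?thesis by simp
  qed
  have "Cauchy m"
  proof (rule CauchyI)
    fix e :: real assume e: "0 < e"
    have "(\<lambda>n. (norm (p - m n))\<^sup>2) \<longlonglongrightarrow> d\<^sup>2"
      by (intro tendsto_power lim)
    then have "eventually (\<lambda>n. (norm (p - m n))\<^sup>2 < d\<^sup>2 + e\<^sup>2 / 4) sequentially"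
      using e by (intro order_tendstoD) auto
    then obtain N where N: "\<And>n. n \<ge> N \<Longrightarrow> (norm (p - m n))\<^sup>2 < d\<^sup>2 + e\<^sup>2 / 4"
      unfolding eventually_sequentially by auto
    show "\<exists>N. \<forall>i\<ge>N. \<forall>j\<ge>N. norm (m i - m j) < e"
    proof (intro exI allI impI)
      fix i j assume "i \<ge> N" "j \<ge> N"
      then have "(norm (m i - m j))\<^sup>2 < e\<^sup>2"
        using par[of i j] N[of i] N[of j] by simp
      then show "norm (m i - m j) < e"
        using e by (meson less_imp_le power2_less_imp_less)
    qed
  qed
  then obtain q where q: "m \<longlonglongrightarrow> q"
    using Cauchy_convergent_iff convergent_def by blast
  have qM: "q \<in> M" using closed_sequentially[OF M(2) mM q] .
  have nq: "norm (p - q) = d"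
    by (rule LIMSEQ_unique[OF _ lim]) (intro tendsto_intros q)
  show ?thesis
  proof (rule that[of "p - q"])
    show "p - q \<noteq> 0" using p qM by auto
    fix h assume h: "h \<in> M"
    show "inner h (p - q) = 0"
    proof (rule ccontr)
      assume hw: "inner h (p - q) \<noteq> 0"
      then have hh: "inner h h > 0" by auto
      \<comment> \<open>The minimiser of the distance from \<open>p\<close> along the line through
        \<open>q\<close> in direction \<open>h\<close>; a nonzero value would beat
        \<open>d\<close>.\<close>
      define t where "t = inner h (p - q) / inner h h"
      have "q + t *\<^sub>R h \<in> M"
        by (intro subspace_scale subspace_add M h qM)
      from low[OF this] have "d\<^sup>2 \<le> (norm (p - (q + t *\<^sub>R h)))\<^sup>2"
        using d0 by (intro power_mono)
      also have "\<dots> = d\<^sup>2 - 2 * t * inner h (p - q) + t\<^sup>2 * inner h h"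
        unfolding nq[symmetric] power2_norm_eq_inner
        by (simp add: inner_simps inner_commute algebra_simps power2_eq_square)
      also have "\<dots> = d\<^sup>2 - (inner h (p - q))\<^sup>2 / inner h h"
        using hh by (simp add: t_def field_simps power2_eq_square)
      finally have "(inner h (p - q))\<^sup>2 / inner h h \<le> 0" by simp
      then show False using hh hw
        by (meson divide_pos_pos linorder_not_le zero_less_power2)
    qed
  qed
qed

text \<open>Real orthogonality to a set closed under complex scalars is complex orthogonality:
  rotate \<open>m\<close> until its inner product with \<open>w\<close> is its own modulus.\<close>

lemma corthogonal_to_closed_subspace:
  fixes M :: "'a::complex_hilbert set"
  assumes M: "subspace M" "closed M" "\<And>c m. m \<in> M \<Longrightarrow> c *\<^sub>C m \<in> M" and p: "p \<notin> M"
  obtains w where "norm w = 1" "\<And>m. m \<in> M \<Longrightarrow> cinner m w = 0"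
proof -
  obtain w where w: "w \<noteq> 0" "\<And>m. m \<in> M \<Longrightarrow> inner m w = 0"
    using orthogonal_to_closed_subspace[OF M(1,2) p] by blast
  have *: "cinner m w = 0" if m: "m \<in> M" for m
  proof -
    obtain u where u: "cmod u = 1" "u * cinner m w = of_real (cmod (cinner m w))"
      by (rule unit_phase)
    have "cmod (cinner m w) = inner (u *\<^sub>C m) w"
      by (simp add: inner_eq_Re_cinner cinner_simps u)
    then show ?thesis using w(2)[OF M(3)[OF m]] by simp
  qed
  show ?thesis
    by (rule that[of "(1 / norm w) *\<^sub>R w"]) (use w * in \<open>auto simp: cinner_simps\<close>)
qed

text \<open>The kernel of \<open>f\<close> has codimension at most one, so a unit vector
  \<open>w\<close> orthogonal to it represents \<open>f\<close> after scaling by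
  \<open>cnj (f w)\<close>.\<close>

lemma riesz_representation:
  fixes f :: "'a::complex_hilbert \<Rightarrow> complex"
  assumes add: "\<And>x y. f (x + y) = f x + f y" and sc: "\<And>c x. f (c *\<^sub>C x) = c * f x"
    and bd: "\<And>x. cmod (f x) \<le> K * norm x"
  shows "\<exists>y. \<forall>x. f x = cinner x y"
proof (cases "\<forall>x. f x = 0")
  case True
  then show ?thesis by (intro exI[of _ 0]) simp
next
  case False
  then obtain p where p: "f p \<noteq> 0" by auto
  have scR: "f (r *\<^sub>R x) = of_real r * f x" for r x
    by (metis sc scaleC_of_real)
  have "bounded_linear f"
    by (rule bounded_linear_intro[of _ K]) (use add scR bd in \<open>auto simp: scaleR_conv_of_real mult.commute\<close>)
  then have "closed (f -` {0})"
    by (intro continuous_closed_vimage) (auto simp: linear_continuous_at)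
  moreover have "subspace (f -` {0})"
    unfolding subspace_def using add scR scR[of 0 0] by auto
  ultimately have sub: "subspace (f -` {0})" "closed (f -` {0})" by simp_all
  obtain w where w: "norm w = 1" "\<And>m. m \<in> f -` {0} \<Longrightarrow> cinner m w = 0"
  proof (rule corthogonal_to_closed_subspace[OF sub, of p])
    fix c m assume "m \<in> f -` {0}"
    then show "c *\<^sub>C m \<in> f -` {0}" by (simp add: sc)
  qed (use p in auto)
  have fw: "f w \<noteq> 0"
    using w(2)[of w] w(1) by (auto simp: cinner_self)
  have "f x = cinner x (cnj (f w) *\<^sub>C w)" for x
  proof -
    have "f (x - (f x / f w) *\<^sub>C w) = 0"
      using add[of "x - (f x / f w) *\<^sub>C w" "(f x / f w) *\<^sub>C w"] fw by (simp add: sc)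
    then have "cinner x w = f x / f w"
      using w(2)[of "x - (f x / f w) *\<^sub>C w"] w(1) by (simp add: cinner_simps cinner_self)
    then show ?thesis using fw by (simp add: cinner_simps)
  qed
  then show ?thesis by blast
qed

lemma cinner_eqI:
  fixes a b :: "'a::complex_hilbert"
  assumes "\<And>x. cinner x a = cinner x b"
  shows "a = b"
proof -
  have "cinner (a - b) (a - b) = 0" using assms[of "a - b"] by (simp add: cinner_diff_right)
  then show ?thesis by (simp add: cinner_self)
qed

text \<open>Justifies the definite description behind \<open>cadjoint\<close>: existence comes from
  the Riesz representation, uniqueness from \<open>cinner_eqI\<close>.\<close>

lemma cadjoint:
  assumes A: "bounded_op A"
  shows "cinner (A x) y = cinner x (cadjoint A y)"
proof -
  obtain K where K: "\<And>x. norm (A x) \<le> K * norm x"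
    using bounded_op_bound[OF A] by blast
  have "\<exists>v. \<forall>x. cinner (A x) y = cinner x v" for y
  proof (rule riesz_representation[of _ "K * norm y"])
    fix x
    show "cmod (cinner (A x) y) \<le> K * norm y * norm x"
      using norm_cinner_le[of "A x" y] mult_right_mono[OF K[of x] norm_ge_zero[of y]]
      by (simp add: mult_ac)
  qed (simp_all add: bounded_op_simps[OF A] cinner_simps)
  then obtain B where B: "\<And>y x. cinner (A x) y = cinner x (B y)" by metis
  have "\<forall>x y. cinner (A x) y = cinner x (cadjoint A y)"
    unfolding cadjoint_def
  proof (rule theI[of _ B])
    fix B' assume B': "\<forall>x y. cinner (A x) y = cinner x (B' y)"
    show "B' = B"
      by (rule ext, rule cinner_eqI) (metis B B')
  qed (use B in blast)
  then show ?thesis by blast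
qed

lemma cadjoint':
  assumes A: "bounded_op A"
  shows "cinner (cadjoint A x) y = cinner x (A y)"
  by (metis A cadjoint cinner_commute)

lemma bounded_op_cadjoint:
  assumes A: "bounded_op A"
  shows "bounded_op (cadjoint A)"
proof -
  obtain K where K: "K > 0" "\<And>x. norm (A x) \<le> K * norm x"
    using bounded_op_bound[OF A] by blast
  show ?thesis
  proof (rule bounded_opI[of _ K])
    fix x y c
    show "cadjoint A (x + y) = cadjoint A x + cadjoint A y"
      by (rule cinner_eqI) (simp add: cinner_simps cadjoint[OF A, symmetric])
    show "cadjoint A (c *\<^sub>C x) = c *\<^sub>C cadjoint A x"
      by (rule cinner_eqI) (simp add: cinner_simps cadjoint[OF A, symmetric])
  next
    fix x
    let ?y = "cadjoint A x"
    have "(norm ?y)\<^sup>2 = cmod (cinner ?y ?y)"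
      by (simp add: cinner_self norm_power)
    also have "\<dots> \<le> norm (A ?y) * norm x"
      unfolding cadjoint[OF A, symmetric] by (rule norm_cinner_le)
    also have "\<dots> \<le> K * norm ?y * norm x"
      by (intro mult_right_mono K) auto
    finally have "norm ?y * norm ?y \<le> norm ?y * (K * norm x)"
      by (simp add: power2_eq_square mult_ac)
    then show "norm ?y \<le> K * norm x"
      using K(1) by (cases "norm ?y = 0") auto
  qed
qed

text \<open>If both alternatives fail, \<open>T\<close> is bounded below, hence injective with
  closed range, and nothing is orthogonal to the range, hence \<open>T\<close> is onto; the lower
  bound also bounds the inverse.\<close>

lemma not_invertible_op_cases:
  assumes T: "bounded_op T" and ni: "\<not> invertible_op T"
  shows "(\<forall>\<epsilon>>0. \<exists>x. norm x = 1 \<and> norm (T x) < \<epsilon>) \<or> (\<exists>w. norm w = 1 \<and> (\<forall>x. cinner (T x) w = 0))"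
proof (rule ccontr)
  assume neg: "\<not> ?thesis"
  then obtain \<epsilon> where e: "\<epsilon> > 0" "\<And>x. norm x = 1 \<Longrightarrow> norm (T x) \<ge> \<epsilon>"
    by (meson linorder_not_less)
  have nw: "\<And>w. norm w = 1 \<Longrightarrow> \<exists>x. cinner (T x) w \<noteq> 0" using neg by blast
  have bl: "norm x * \<epsilon> \<le> norm (T x)" for x
  proof (cases "x = 0")
    case False
    have "norm ((1 / norm x) *\<^sub>R x) = 1" using False by simp
    from e(2)[OF this] show ?thesis
      using False by (simp add: bounded_op_simps[OF T] field_simps)
  qed (use T in auto)
  have lin: "bounded_linear T" by (rule bounded_op_imp_bounded_linear[OF T])
  interpret bounded_linear T by (rule lin)
  have "complete (range T)"
    by (rule complete_isometric_image[OF e(1) subspace_UNIV lin])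
      (use bl complete_UNIV in \<open>auto simp: mult.commute\<close>)
  then have cl: "closed (range T)" by (rule complete_imp_closed)
  have sub: "subspace (range T)" by (intro linear_subspace_image linear subspace_UNIV)
  have surj: "range T = UNIV"
  proof (rule ccontr)
    assume "range T \<noteq> UNIV"
    then obtain p where p: "p \<notin> range T" by blast
    obtain w where "norm w = 1" "\<And>m. m \<in> range T \<Longrightarrow> cinner m w = 0"
    proof (rule corthogonal_to_closed_subspace[OF sub cl])
      fix c m assume "m \<in> range T"
      then obtain x where "m = T x" by blast
      then show "c *\<^sub>C m \<in> range T"
        by (intro range_eqI[of _ _ "c *\<^sub>C x"]) (simp add: bounded_op_scaleC[OF T])
    qed (use p in blast)+
    then show False using nw by blast
  qed
  have inj: "inj T"
  proof (rule injI)
    fix x y assume "T x = T y"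
    then have "norm (x - y) * \<epsilon> \<le> 0" using bl[of "x - y"] by (simp add: diff)
    then show "x = y" using e(1) by (simp add: mult_le_0_iff)
  qed
  have TI: "T (inv T x) = x" for x using surj by (simp add: surj_f_inv_f)
  have "bounded_op (inv T)"
  proof (rule bounded_opI[of _ "1 / \<epsilon>"])
    fix x y c
    show "inv T (x + y) = inv T x + inv T y"
      by (rule injD[OF inj]) (simp add: TI add)
    show "inv T (c *\<^sub>C x) = c *\<^sub>C inv T x"
      by (rule injD[OF inj]) (simp add: TI bounded_op_scaleC[OF T])
    show "norm (inv T x) \<le> 1 / \<epsilon> * norm x"
      using bl[of "inv T x"] e(1) by (simp add: TI field_simps)
  qed
  then have "invertible_op T"
    unfolding invertible_op_def using T inj
    by (intro conjI exI[of _ "inv T"]) (auto simp: TI inv_f_f)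
  then show False using ni by simp
qed

lemma not_bounded_below_imp_not_invertible:
  assumes "\<And>\<epsilon>. \<epsilon> > 0 \<Longrightarrow> \<exists>x. norm x = 1 \<and> norm (T x) \<le> \<epsilon>"
  shows "\<not> invertible_op T"
proof
  assume "invertible_op T"
  then obtain B where B: "bounded_op B" "B \<circ> T = id"
    unfolding invertible_op_def by auto
  obtain K where K: "K > 0" "\<And>x. norm (B x) \<le> K * norm x"
    using bounded_op_bound[OF B(1)] by blast
  obtain x where x: "norm x = 1" "norm (T x) \<le> 1 / (2 * K)"
    using assms[of "1 / (2 * K)"] K(1) by auto
  have "1 = norm (B (T x))" using B(2) x(1) by (metis comp_apply id_apply)
  also have "\<dots> \<le> K * norm (T x)" by (rule K)
  also have "\<dots> \<le> K * (1 / (2 * K))" using x(2) K(1) by (intro mult_left_mono) auto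
  finally show False using K(1) by simp
qed

section \<open>Quadratic forms\<close>

text \<open>The usual discriminant argument along one real line. Assuming only the expansion on that
  line makes it applicable to the real forms obtained from nonsymmetric operators.\<close>

lemma quadratic_form_cauchy_schwarz:
  fixes q :: "'a::real_vector \<Rightarrow> real"
  assumes nn: "\<And>z. q z \<ge> 0" and ex: "\<And>t. q (x + t *\<^sub>R y) = q x + 2 * t * h + t\<^sup>2 * q y"
  shows "h\<^sup>2 \<le> q x * q y"
proof (cases "q y = 0")
  case True
  have "h = 0"
  proof (rule ccontr)
    assume h: "h \<noteq> 0"
    \<comment> \<open>With \<open>q y = 0\<close> the expansion is affine in \<open>t\<close>; this
      \<open>t\<close> gives it the value -1.\<close>
    have "0 \<le> q x + 2 * (- (q x + 1) / (2 * h)) * h"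
      using nn[of "x + (- (q x + 1) / (2 * h)) *\<^sub>R y"] unfolding ex by (simp add: True)
    then show False using h by (simp add: field_simps)
  qed
  then show ?thesis using True by simp
next
  case False
  then have qy: "q y > 0" using nn[of y] by simp
  have "0 \<le> q x + 2 * (- h / q y) * h + (- h / q y)\<^sup>2 * q y"
    using nn[of "x + (- h / q y) *\<^sub>R y"] unfolding ex .
  also have "\<dots> = q x - h\<^sup>2 / q y"
    using qy by (simp add: field_simps power2_eq_square)
  finally show ?thesis using qy by (simp add: field_simps)
qed

lemma symmetric_psd_cauchy_schwarz:
  fixes R :: "'a::real_inner \<Rightarrow> 'a"
  assumes lin: "bounded_linear R" and sym: "\<And>x y. inner (R x) y = inner x (R y)"
    and psd: "\<And>x. inner (R x) x \<ge> 0"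
  shows "(inner (R x) y)\<^sup>2 \<le> inner (R x) x * inner (R y) y"
proof (rule quadratic_form_cauchy_schwarz[where q = "\<lambda>x. inner (R x) x"])
  interpret bounded_linear R by fact
  have s: "inner (R y) x = inner (R x) y" by (metis sym inner_commute)
  show "inner (R (x + t *\<^sub>R y)) (x + t *\<^sub>R y)
      = inner (R x) x + 2 * t * inner (R x) y + t\<^sup>2 * inner (R y) y" for t
    by (simp add: add scaleR inner_simps s algebra_simps power2_eq_square)
qed (rule psd)

text \<open>Cauchy-Schwarz for the form of \<open>R\<close>, applied to \<open>x\<close> and
  \<open>R x\<close>. It converts a small value of the form into a small vector.\<close>

lemma symmetric_psd_norm_le:
  fixes R :: "'a::real_inner \<Rightarrow> 'a"
  assumes lin: "bounded_linear R" and sym: "\<And>x y. inner (R x) y = inner x (R y)"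
    and psd: "\<And>x. inner (R x) x \<ge> 0" and bd: "\<And>x. norm (R x) \<le> M * norm x"
  shows "(norm (R x))\<^sup>2 \<le> M * inner (R x) x"
proof (cases "R x = 0")
  case False
  have "((norm (R x))\<^sup>2)\<^sup>2 \<le> inner (R x) x * inner (R (R x)) (R x)"
    using symmetric_psd_cauchy_schwarz[OF lin sym psd, of x "R x"]
    by (simp add: power2_norm_eq_inner)
  also have "\<dots> \<le> inner (R x) x * (M * (norm (R x))\<^sup>2)"
  proof (rule mult_left_mono[OF _ psd])
    have "inner (R (R x)) (R x) \<le> norm (R (R x)) * norm (R x)" by (rule norm_cauchy_schwarz)
    also have "\<dots> \<le> M * norm (R x) * norm (R x)" by (intro mult_right_mono bd) auto
    finally show "inner (R (R x)) (R x) \<le> M * (norm (R x))\<^sup>2" by (simp add: power2_eq_square)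
  qed
  finally have "(norm (R x))\<^sup>2 * (norm (R x))\<^sup>2 \<le> (norm (R x))\<^sup>2 * (M * inner (R x) x)"
    by (simp only: power2_eq_square mult_ac)
  then show ?thesis
    using False by (metis mult_le_cancel_left_pos zero_less_norm_iff zero_less_power)
qed simp

text \<open>
  A substitute for the spectral theorem: among the vectors that almost annihilate \<open>Q\<close> one almost
  maximises \<open>\<langle>K y, y\<rangle>\<close>. If \<open>k\<close> is the limiting maximum then \<open>k + \<eta> - K + C Q\<close> is positive for a
  suitable \<open>C\<close> and almost annihilates \<open>y\<close>; commutativity controls the contribution of \<open>C Q\<close>.
\<close>

lemma commuting_joint_approx_eigenvector:
  fixes Q K :: "'a::real_inner \<Rightarrow> 'a"
  assumes Q: "bounded_linear Q" and K: "bounded_linear K"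
    and symQ: "\<And>x y. inner (Q x) y = inner x (Q y)" and symK: "\<And>x y. inner (K x) y = inner x (K y)"
    and comm: "\<And>x. Q (K x) = K (Q x)"
    and psd: "\<And>x. inner (Q x) x \<ge> 0"
    and inf: "\<And>\<epsilon>. \<epsilon> > 0 \<Longrightarrow> \<exists>x. norm x = 1 \<and> inner (Q x) x \<le> \<epsilon>"
  shows "\<exists>k. \<forall>\<epsilon>>0. \<exists>y. norm y = 1 \<and> norm (Q y) \<le> \<epsilon> \<and> norm (K y - k *\<^sub>R y) \<le> \<epsilon>"
proof -
  interpret Q: bounded_linear Q by (rule Q)
  interpret K: bounded_linear K by (rule K)
  obtain M1 where M1: "M1 > 0" "\<And>x. norm (Q x) \<le> norm x * M1"
    using Q.pos_bounded by blast
  obtain M2 where M2: "M2 > 0" "\<And>x. norm (K x) \<le> norm x * M2"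
    using K.pos_bounded by blast
  define M where "M = max M1 M2"
  have M0: "M > 0" using M1(1) by (simp add: M_def)
  have bQ: "norm (Q x) \<le> M * norm x" for x
    using M1(2)[of x] mult_left_mono[of M1 M "norm x"] by (simp add: M_def mult.commute)
  have bK: "norm (K x) \<le> M * norm x" for x
    using M2(2)[of x] mult_left_mono[of M2 M "norm x"] by (simp add: M_def mult.commute)
  have iK: "\<bar>inner (K x) x\<bar> \<le> M" if "norm x = 1" for x
    using Cauchy_Schwarz_ineq2[of "K x" x] bK[of x] that by simp
  \<comment> \<open>\<open>Z\<close> holds the levels that the form of \<open>K\<close> reaches on
    unit vectors whose \<open>Q\<close>-form is arbitrarily small; its supremum is the limiting
    maximum.\<close>
  define Z where "Z = {k. \<forall>\<epsilon>>0. \<exists>y. norm y = 1 \<and> inner (Q y) y \<le> \<epsilon> \<and> k \<le> inner (K y) y}"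
  define k where "k = Sup Z"
  have Zne: "- M \<in> Z"
    unfolding Z_def using inf iK by (force simp: abs_le_iff)
  have Zle: "x \<le> M" if "x \<in> Z" for x
  proof -
    obtain y where "norm y = 1" "x \<le> inner (K y) y"
      using \<open>x \<in> Z\<close> unfolding Z_def by (auto dest: spec[of _ 1])
    then show ?thesis using iK[of y] by linarith
  qed
  have bdd: "bdd_above Z" using Zle by (auto simp: bdd_above_def)
  have kM: "\<bar>k\<bar> \<le> M"
    using cSup_upper[OF Zne bdd] cSup_least[of Z M] Zle Zne by (auto simp: k_def abs_le_iff)
  \<comment> \<open>Dominates \<open>\<bar>l\<bar> + M\<close> for every
    \<open>l = k + \<eta>\<close> with \<open>\<eta> \<le> 1\<close>, hence bounds
    \<open>K - l\<close> uniformly in \<open>s\<close>.\<close>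
  define L where "L = 2 * M + 1"
  have L1: "L \<ge> 1" using M0 by (simp add: L_def)
  define E where "E = sqrt (6 * L ^ 3) + L"
  have E0: "E > 0" using L1 by (simp add: E_def add_nonneg_pos)
  \<comment> \<open>The shift by \<open>s\<^sup>2\<close> puts the level just outside
    \<open>Z\<close>. The error is of order \<open>s\<close>, not \<open>s\<^sup>2\<close>, because
    Cauchy-Schwarz takes the root of a form value of order \<open>s\<^sup>2\<close>;
    \<open>E\<close> adds up both error terms.\<close>
  have main: "\<exists>y. norm y = 1 \<and> norm (Q y) \<le> s\<^sup>2 \<and> (norm (K y - (k + s\<^sup>2) *\<^sub>R y))\<^sup>2 \<le> s * E"
    if s: "0 < s" "s \<le> 1" for s
  proof -
    define \<eta> where "\<eta> = s\<^sup>2"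
    have eta: "0 < \<eta>" "\<eta> \<le> 1" "\<eta> \<le> s"
      using s by (auto simp: \<eta>_def power_le_one) (simp add: power2_eq_square mult_left_le)
    define l where "l = k + \<eta>"
    have lM: "\<bar>l\<bar> + M \<le> L" using kM eta by (simp add: l_def L_def)
    have "l \<notin> Z" using cSup_upper[OF _ bdd, of l] eta(1) by (auto simp: l_def k_def)
    then obtain \<epsilon>0 where e0: "\<epsilon>0 > 0"
      "\<And>y. norm y = 1 \<Longrightarrow> inner (Q y) y \<le> \<epsilon>0 \<Longrightarrow> inner (K y) y < l"
      unfolding Z_def mem_Collect_eq by (meson not_le)
    \<comment> \<open>Chosen so that \<open>C * \<epsilon>0\<close> outweighs the worst negative
      value of the form of \<open>l - K\<close>; where the \<open>Q\<close>-form is at most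
      \<open>\<epsilon>0\<close>, that form is already positive.\<close>
    define C where "C = (\<bar>l\<bar> + M) / \<epsilon>0"
    have C0: "C \<ge> 0" using e0 M0 by (simp add: C_def)
    define R where "R = (\<lambda>x. l *\<^sub>R x - K x + C *\<^sub>R Q x)"
    have linR: "bounded_linear R"
      unfolding R_def by (intro bounded_linear_intros K Q)
    have symR: "inner (R x) y = inner x (R y)" for x y
      by (simp add: R_def inner_simps symK symQ)
    have unitR: "inner (R x) x \<ge> 0" if x: "norm x = 1" for x
    proof (cases "inner (Q x) x \<le> \<epsilon>0")
      case True
      have "inner (K x) x < l" using e0(2)[OF x True] .
      moreover have "inner x x = 1" using x by (simp add: norm_eq_1)
      ultimately show ?thesis using C0 psd[of x] by (simp add: R_def inner_simps)
    next
      case False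
      have "\<bar>l\<bar> + M = C * \<epsilon>0" using e0(1) by (simp add: C_def)
      also have "\<dots> \<le> C * inner (Q x) x" using False C0 by (intro mult_left_mono) auto
      finally have "\<bar>l\<bar> + M \<le> C * inner (Q x) x" .
      moreover have "inner x x = 1" using x by (simp add: norm_eq_1)
      ultimately show ?thesis using iK[OF x] by (simp add: R_def inner_simps)
    qed
    have psdR: "inner (R x) x \<ge> 0" for x
    proof (cases "x = 0")
      case False
      interpret R: bounded_linear R by (rule linR)
      have "0 \<le> inner (R ((1 / norm x) *\<^sub>R x)) ((1 / norm x) *\<^sub>R x)"
        by (rule unitR) (use False in simp)
      also have "\<dots> = inner (R x) x / (norm x)\<^sup>2"
        by (simp add: R.scaleR power2_eq_square)
      finally show ?thesis using False by (simp add: zero_le_divide_iff)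
    qed simp
    \<comment> \<open>The first entry keeps \<open>C * inner (Q y) y\<close> below
      \<open>\<eta>\<close>; the second, through \<open>symmetric_psd_norm_le\<close>, keeps both
      \<open>norm (Q y)\<close> and \<open>C * norm (Q y)\<close> below
      \<open>\<eta>\<close>.\<close>
    define \<epsilon>1 where "\<epsilon>1 = min (\<eta> / (C + 1)) ((\<eta> / (C + 1))\<^sup>2 / M)"
    have e1: "\<epsilon>1 > 0" using eta C0 M0 by (simp add: \<epsilon>1_def)
    have "k - \<eta> < Sup Z" using eta by (simp add: k_def)
    then obtain k' where k': "k' \<in> Z" "k - \<eta> < k'"
      using less_cSup_iff[of Z "k - \<eta>"] Zne bdd by auto
    then obtain y where y: "norm y = 1" "inner (Q y) y \<le> \<epsilon>1" "k - \<eta> \<le> inner (K y) y"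
      using e1 unfolding Z_def by force
    have "(norm (Q y))\<^sup>2 \<le> M * inner (Q y) y"
      by (rule symmetric_psd_norm_le[OF Q symQ psd bQ])
    also have "\<dots> \<le> M * ((\<eta> / (C + 1))\<^sup>2 / M)"
      using y(2) M0 by (intro mult_left_mono) (auto simp: \<epsilon>1_def)
    also have "\<dots> = (\<eta> / (C + 1))\<^sup>2" using M0 by simp
    finally have nQ: "norm (Q y) \<le> \<eta> / (C + 1)"
      by (rule power2_le_imp_le) (use eta(1) C0 in simp)
    then have nQ2: "(C + 1) * norm (Q y) \<le> \<eta>" using C0 by (simp add: field_simps)
    have "C * norm (Q y) \<ge> 0" using C0 by simp
    then have nQ3: "C * norm (Q y) \<le> \<eta>" "norm (Q y) \<le> \<eta>"
      using nQ2 norm_ge_zero[of "Q y"] unfolding distrib_right by linarith+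
    define z where "z = K y - l *\<^sub>R y"
    have nz: "norm z \<le> L"
      using norm_triangle_ineq4[of "K y" "l *\<^sub>R y"] bK[of y] y(1) lM by (simp add: z_def)
    have Ry: "inner (R y) y \<le> 3 * \<eta>"
    proof -
      have "C * inner (Q y) y \<le> C * (\<eta> / (C + 1))"
        using y(2) C0 by (intro mult_left_mono) (auto simp: \<epsilon>1_def)
      also have "\<dots> \<le> \<eta>" using C0 eta(1) by (simp add: field_simps)
      finally have "C * inner (Q y) y \<le> \<eta>" .
      moreover have "inner y y = 1" using y(1) by (simp add: norm_eq_1)
      ultimately show ?thesis using y(3) by (simp add: R_def inner_simps l_def)
    qed
    have Rz: "inner (R z) z \<le> 2 * L ^ 3"
    proof -
      \<comment> \<open>Commutativity makes \<open>Q z\<close> as small as \<open>Q y\<close>, so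
        the large factor \<open>C\<close>, which depends on \<open>s\<close>, does no harm to the
        form of \<open>R\<close> at \<open>z\<close>.\<close>
      have Qz: "Q z = K (Q y) - l *\<^sub>R Q y" by (simp add: z_def Q.diff Q.scaleR comm)
      have "norm (Q z) \<le> M * norm (Q y) + \<bar>l\<bar> * norm (Q y)"
        unfolding Qz using norm_triangle_ineq4[of "K (Q y)" "l *\<^sub>R Q y"] bK[of "Q y"] by simp
      also have "\<dots> = (\<bar>l\<bar> + M) * norm (Q y)" by (simp add: algebra_simps)
      also have "\<dots> \<le> L * norm (Q y)" by (intro mult_right_mono lM) auto
      finally have nQz: "norm (Q z) \<le> L * norm (Q y)" .
      have "C * inner (Q z) z \<le> C * (norm (Q z) * norm z)"
        by (intro mult_left_mono C0 norm_cauchy_schwarz)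
      also have "\<dots> \<le> C * ((L * norm (Q y)) * L)"
        using nQz nz L1 by (intro mult_left_mono mult_mono C0) auto
      also have "\<dots> = (C * norm (Q y)) * L\<^sup>2" by (simp add: power2_eq_square)
      also have "\<dots> \<le> 1 * L\<^sup>2" using nQ3 eta(2) by (intro mult_right_mono) auto
      also have "\<dots> \<le> L ^ 3" using L1 by (simp add: power_increasing)
      finally have 1: "C * inner (Q z) z \<le> L ^ 3" .
      have "inner (l *\<^sub>R z - K z) z \<le> norm (l *\<^sub>R z - K z) * norm z" by (rule norm_cauchy_schwarz)
      also have "\<dots> \<le> ((\<bar>l\<bar> + M) * norm z) * norm z"
        using norm_triangle_ineq4[of "l *\<^sub>R z" "K z"] bK[of z]
        by (intro mult_right_mono) (auto simp: algebra_simps)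
      also have "\<dots> \<le> (L * L) * L"
        using nz lM L1 M0 by (intro mult_mono) auto
      finally have "inner (l *\<^sub>R z - K z) z \<le> L ^ 3" by (simp add: power3_eq_cube)
      then show ?thesis using 1 by (simp add: R_def inner_simps)
    qed
    have "(inner (R y) z)\<^sup>2 \<le> inner (R y) y * inner (R z) z"
      by (rule symmetric_psd_cauchy_schwarz[OF linR symR psdR])
    also have "\<dots> \<le> (3 * \<eta>) * (2 * L ^ 3)"
      using Ry Rz psdR eta(1) by (intro mult_mono) auto
    also have "\<dots> = (s * sqrt (6 * L ^ 3))\<^sup>2"
      using L1 by (simp add: \<eta>_def power_mult_distrib)
    finally have "\<bar>inner (R y) z\<bar>\<^sup>2 \<le> (s * sqrt (6 * L ^ 3))\<^sup>2" by simp
    then have RR: "\<bar>inner (R y) z\<bar> \<le> s * sqrt (6 * L ^ 3)"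
      by (rule power2_le_imp_le) (use s L1 in simp)
    have "(norm z)\<^sup>2 = inner z z" by (simp add: power2_norm_eq_inner)
    also have "z = C *\<^sub>R Q y - R y" by (simp add: z_def R_def)
    then have "inner z z = C * inner (Q y) z - inner (R y) z"
      by (metis inner_diff_left inner_scaleR_left)
    also have "\<dots> \<le> \<eta> * L + s * sqrt (6 * L ^ 3)"
    proof -
      have "C * inner (Q y) z \<le> C * (norm (Q y) * norm z)"
        by (intro mult_left_mono C0 norm_cauchy_schwarz)
      also have "\<dots> \<le> \<eta> * L"
        unfolding mult.assoc[symmetric] using nQ3 nz eta(1) by (intro mult_mono) auto
      finally show ?thesis using RR by linarith
    qed
    also have "\<dots> \<le> s * E"
      using eta(3) L1 by (simp add: E_def distrib_left mult_right_mono)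
    finally show ?thesis
      using y(1) nQ3(2) by (intro exI[of _ y]) (simp add: z_def l_def \<eta>_def)
  qed
  show ?thesis
  proof (rule exI[of _ k], intro allI impI)
    fix \<epsilon> :: real assume e: "\<epsilon> > 0"
    define s where "s = min 1 (min (\<epsilon> / 2) ((\<epsilon> / 2)\<^sup>2 / E))"
    have s: "0 < s" "s \<le> 1" "s \<le> \<epsilon> / 2" "s \<le> (\<epsilon> / 2)\<^sup>2 / E"
      using e E0 unfolding s_def by (auto simp only: min_less_iff_conj intro: min.coboundedI1 min.coboundedI2) auto
    obtain y where y: "norm y = 1" "norm (Q y) \<le> s\<^sup>2" "(norm (K y - (k + s\<^sup>2) *\<^sub>R y))\<^sup>2 \<le> s * E"
      using main[OF s(1,2)] by blast
    have s2: "s\<^sup>2 \<le> \<epsilon> / 2"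
      using s by (smt (verit) mult_left_le power2_eq_square)
    have "s * E \<le> (\<epsilon> / 2)\<^sup>2" using s(4) E0 by (simp add: field_simps)
    with y(3) have "(norm (K y - (k + s\<^sup>2) *\<^sub>R y))\<^sup>2 \<le> (\<epsilon> / 2)\<^sup>2" by simp
    then have "norm (K y - (k + s\<^sup>2) *\<^sub>R y) \<le> \<epsilon> / 2"
      by (rule power2_le_imp_le) (use e in simp)
    moreover have "norm (K y - k *\<^sub>R y) \<le> norm (K y - (k + s\<^sup>2) *\<^sub>R y) + norm (s\<^sup>2 *\<^sub>R y)"
      using norm_triangle_ineq[of "K y - (k + s\<^sup>2) *\<^sub>R y" "s\<^sup>2 *\<^sub>R y"] by (simp add: algebra_simps)
    ultimately have "norm (K y - k *\<^sub>R y) \<le> \<epsilon>"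
      using s2 y(1) by simp
    then show "\<exists>y. norm y = 1 \<and> norm (Q y) \<le> \<epsilon> \<and> norm (K y - k *\<^sub>R y) \<le> \<epsilon>"
      using y(1,2) s2 e by (intro exI[of _ y]) auto
  qed
qed

section \<open>The numerical range\<close>

lemma numerical_range_memI: "norm x = 1 \<Longrightarrow> cinner (A x) x \<in> numerical_range A"
  by (auto simp: numerical_range_def)

lemma numerical_range_memI':
  assumes "bounded_op A" "x \<noteq> 0"
  shows "cinner (A x) x / of_real ((norm x)\<^sup>2) \<in> numerical_range A"
proof -
  have "cinner (A ((1 / norm x) *\<^sub>R x)) ((1 / norm x) *\<^sub>R x) \<in> numerical_range A"
    by (rule numerical_range_memI) (use assms in simp)
  then show ?thesis
    using assms by (simp add: bounded_op_simps cinner_simps power2_eq_square)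
qed

lemma numerical_range_bounded:
  assumes "\<And>x. norm (A x) \<le> K * norm x" "w \<in> numerical_range A"
  shows "cmod w \<le> K"
proof -
  obtain x where x: "norm x = 1" "w = cinner (A x) x"
    using assms(2) by (auto simp: numerical_range_def)
  then show ?thesis using norm_cinner_le[of "A x" x] assms(1)[of x] by simp
qed

text \<open>An affine change of the operator moves \<open>a\<close> and \<open>b\<close> to 0 and 1.
  After rotating \<open>x\<close>, the normalised form is real on the segment from \<open>x\<close>
  to \<open>y\<close>, and the intermediate value theorem finds the required value.\<close>

theorem toeplitz_hausdorff:
  assumes A: "bounded_op A"
  shows "convex (numerical_range A)"
  unfolding convex_alt
proof (intro ballI allI impI)
  fix a b :: complex and u :: real
  assume a: "a \<in> numerical_range A" and b: "b \<in> numerical_range A" and u: "0 \<le> u \<and> u \<le> 1"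
  show "(1 - u) *\<^sub>R a + u *\<^sub>R b \<in> numerical_range A"
  proof (cases "a = b")
    case True
    then show ?thesis using a by (simp flip: scaleR_left_distrib)
  next
    case False
    obtain x y where x: "norm x = 1" "a = cinner (A x) x" and y: "norm y = 1" "b = cinner (A y) y"
      using a b by (auto simp: numerical_range_def)
    define \<beta> where "\<beta> = (\<lambda>z w. (cinner (A z) w - a * cinner z w) / (b - a))"
    have beta_add: "\<beta> (z + z') w = \<beta> z w + \<beta> z' w" "\<beta> w (z + z') = \<beta> w z + \<beta> w z'" for z z' w
      by (simp_all add: \<beta>_def bounded_op_simps[OF A] cinner_simps algebra_simps
          flip: add_divide_distrib)
    have beta_sc: "\<beta> (c *\<^sub>C z) w = c * \<beta> z w" "\<beta> z (c *\<^sub>C w) = cnj c * \<beta> z w" for c z w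
      by (simp_all add: \<beta>_def bounded_op_simps[OF A] cinner_simps algebra_simps)
    have beta_scR: "\<beta> (r *\<^sub>R z) w = of_real r * \<beta> z w" "\<beta> z (r *\<^sub>R w) = of_real r * \<beta> z w" for r z w
      by (simp_all flip: scaleC_of_real add: beta_sc)
    have bxx: "\<beta> x x = 0" "\<beta> y y = 1"
      using x y False by (simp_all add: \<beta>_def cinner_self)
    \<comment> \<open>This phase makes the sum of the two cross terms of \<open>\<beta>\<close>
      real.\<close>
    obtain \<omega> where om: "cmod \<omega> = 1" "\<omega> * (\<beta> x y - cnj (\<beta> y x)) = of_real (cmod (\<beta> x y - cnj (\<beta> y x)))"
      by (rule unit_phase)
    define x' where "x' = \<omega> *\<^sub>C x"
    have x': "norm x' = 1" "\<beta> x' x' = 0"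
      using x om by (simp_all add: x'_def norm_scaleC beta_sc bxx)
    have "Im (\<beta> x' y + \<beta> y x') = Im (\<omega> * (\<beta> x y - cnj (\<beta> y x)))"
      by (simp add: x'_def beta_sc algebra_simps)
    then have im: "Im (\<beta> x' y + \<beta> y x') = 0" by (simp only: om(2) Im_complex_of_real)
    define r where "r = Re (\<beta> x' y + \<beta> y x')"
    have r: "\<beta> x' y + \<beta> y x' = of_real r"
      using im by (simp add: r_def complex_eq_iff)
    define z where "z = (\<lambda>t::real. (1 - t) *\<^sub>R x' + t *\<^sub>R y)"
    \<comment> \<open>If \<open>t *\<^sub>R y\<close> were a multiple of \<open>x'\<close>, then
      \<open>\<beta>\<close> would take on it both the value \<open>t\<^sup>2\<close> and the value
      0.\<close>
    have z0: "z t \<noteq> 0" for t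
    proof
      assume "z t = 0"
      then have eq: "t *\<^sub>R y = (- (1 - t)) *\<^sub>R x'"
        by (metis add_eq_0_iff scaleR_minus_left z_def)
      have "of_real (t\<^sup>2) = \<beta> (t *\<^sub>R y) (t *\<^sub>R y)"
        by (simp add: beta_scR bxx power2_eq_square)
      also have "\<dots> = 0" unfolding eq by (simp only: beta_scR x' mult_zero_right)
      finally have "t = 0" by simp
      then show False using eq x' by simp
    qed
    define f where "f = (\<lambda>t. (t * (1 - t) * r + t\<^sup>2) / (norm (z t))\<^sup>2)"
    have bz: "\<beta> (z t) (z t) = of_real (t * (1 - t) * r + t\<^sup>2)" for t
    proof -
      have "\<beta> (z t) (z t) = of_real (t * (1 - t)) * (\<beta> x' y + \<beta> y x') + of_real (t\<^sup>2)"
        unfolding z_def beta_add beta_scR x' bxx by (simp add: power2_eq_square algebra_simps)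
      then show ?thesis unfolding r by simp
    qed
    have "continuous_on {0..1} f"
      unfolding f_def z_def by (intro continuous_intros) (use z0 in \<open>auto simp: z_def\<close>)
    moreover have "f 0 \<le> u" "u \<le> f 1" using u y by (simp_all add: f_def z_def)
    ultimately obtain t where t: "f t = u"
      using IVT'[of f 0 u 1] by auto
    have "cinner (A (z t)) (z t) / of_real ((norm (z t))\<^sup>2) = a + (b - a) * \<beta> (z t) (z t) / of_real ((norm (z t))\<^sup>2)"
      using z0[of t] False by (simp add: \<beta>_def cinner_self field_simps)
    also have "\<dots> = a + (b - a) * of_real u"
      unfolding bz t[symmetric] f_def by simp
    also have "\<dots> = (1 - u) *\<^sub>R a + u *\<^sub>R b"
      by (simp add: scaleR_conv_of_real algebra_simps)
    finally show ?thesis using numerical_range_memI'[OF A z0[of t]] by simp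
  qed
qed

text \<open>The two bounds say that \<open>A e\<close> is within \<open>\<epsilon>\<close> of
  \<open>l e\<close>, and the adjoint at \<open>e\<close> within \<open>\<epsilon>\<close> of
  \<open>cnj l e\<close>. The weak form is what bounds on sesquilinear forms deliver
  directly.\<close>

definition reducing_approx_eigenvalue :: "('a::complex_hilbert \<Rightarrow> 'a) \<Rightarrow> complex \<Rightarrow> bool" where
  "reducing_approx_eigenvalue A l \<longleftrightarrow>
     (\<forall>\<epsilon>>0. \<exists>e. norm e = 1 \<and>
       (\<forall>z. cmod (cinner (A e) z - l * cinner e z) \<le> \<epsilon> * norm z \<and>
            cmod (cinner (A z) e - l * cinner z e) \<le> \<epsilon> * norm z))"

text \<open>The sector condition makes the real forms Re + s Im of \<open>G\<close> nonnegative for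
  s = \<open>\<tau>\<close> and s = -\<open>\<tau>\<close>. Cauchy-Schwarz for both controls the
  symmetrised form, so a small \<open>Re (cinner (G x) x)\<close> makes \<open>G\<close> and its
  adjoint small at \<open>x\<close>.\<close>

lemma sectorial_form_bound:
  assumes G: "bounded_op G" and K: "K > 0" "\<And>x. norm (G x) \<le> K * norm x" and tau: "\<tau> > 0"
    and sec: "\<And>x. \<tau> * \<bar>Im (cinner (G x) x)\<bar> \<le> Re (cinner (G x) x)"
  defines "E \<equiv> \<lambda>x y. (1 + 1 / \<tau>) * (4 * sqrt (K * Re (cinner (G x) x)) * norm y)"
  shows "cmod (cinner (G x) y) \<le> E x y" "cmod (cinner (G y) x) \<le> E x y"
proof -
  define r where "r = Re (cinner (G x) x)"
  have r0: "r \<ge> 0" using order_trans[OF _ sec[of x], of 0] tau by (simp add: r_def)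
  have sym: "cmod (cinner (G x) y + cinner (G y) x) \<le> (1 + 1 / \<tau>) * (4 * sqrt (K * r) * norm y)" for y
  proof -
    define \<alpha> where "\<alpha> = cinner (G x) y + cinner (G y) x"
    define F where "F = 4 * sqrt (K * r) * norm y"
    have *: "\<bar>Re \<alpha> + s * Im \<alpha>\<bar> \<le> F" if s: "\<bar>s\<bar> = \<tau>" for s
    proof -
      define q where "q = (\<lambda>x. Re (cinner (G x) x) + s * Im (cinner (G x) x))"
      have sI: "\<bar>s * Im (cinner (G z) z)\<bar> \<le> Re (cinner (G z) z)" for z
        using sec[of z] s by (simp add: abs_mult)
      have q0: "q z \<ge> 0" and q2: "q z \<le> 2 * Re (cinner (G z) z)" for z
        using sI[of z] by (auto simp: q_def)
      have "((Re \<alpha> + s * Im \<alpha>) / 2)\<^sup>2 \<le> q x * q y"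
      proof (rule quadratic_form_cauchy_schwarz[OF q0])
        show "q (x + t *\<^sub>R y) = q x + 2 * t * ((Re \<alpha> + s * Im \<alpha>) / 2) + t\<^sup>2 * q y" for t
          by (simp add: q_def \<alpha>_def bounded_op_simps[OF G] cinner_simps algebra_simps power2_eq_square)
      qed
      also have "\<dots> \<le> (2 * r) * (2 * (K * (norm y)\<^sup>2))"
      proof (intro mult_mono q0)
        have "Re (cinner (G y) y) \<le> norm (G y) * norm y"
          by (rule order_trans[OF complex_Re_le_cmod norm_cinner_le])
        also have "\<dots> \<le> K * norm y * norm y" by (intro mult_right_mono K) auto
        finally show "q y \<le> 2 * (K * (norm y)\<^sup>2)" using q2[of y] by (simp add: power2_eq_square)
      qed (use q2[of x] r0 in \<open>auto simp: r_def\<close>)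
      also have "\<dots> = (2 * sqrt (K * r) * norm y)\<^sup>2"
        using r0 K(1) by (simp add: power_mult_distrib)
      finally have "\<bar>(Re \<alpha> + s * Im \<alpha>) / 2\<bar>\<^sup>2 \<le> (2 * sqrt (K * r) * norm y)\<^sup>2" by (simp only: power2_abs)
      then have "\<bar>(Re \<alpha> + s * Im \<alpha>) / 2\<bar> \<le> 2 * sqrt (K * r) * norm y"
        by (rule power2_le_imp_le) (use r0 K(1) in simp)
      then show ?thesis by (simp add: F_def)
    qed
    have 1: "\<bar>Re \<alpha>\<bar> \<le> F" "\<tau> * \<bar>Im \<alpha>\<bar> \<le> F"
      using *[of \<tau>] *[of "-\<tau>"] tau by (auto simp: abs_if split: if_splits)
    have "cmod \<alpha> \<le> \<bar>Re \<alpha>\<bar> + \<bar>Im \<alpha>\<bar>" by (rule cmod_le)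
    also have "\<dots> \<le> F + F / \<tau>" using 1 tau by (intro add_mono) (auto simp: field_simps)
    also have "\<dots> = (1 + 1 / \<tau>) * F" by (simp add: algebra_simps)
    finally show ?thesis by (simp add: \<alpha>_def F_def)
  qed
  define B where "B = (1 + 1 / \<tau>) * (4 * sqrt (K * r) * norm y)"
  have 1: "cmod (cinner (G x) y + cinner (G y) x) \<le> B" using sym[of y] by (simp add: B_def)
  \<comment> \<open>Replacing \<open>y\<close> by \<open>\<i> *\<^sub>C y\<close> turns the sum of
    the two mixed terms into their difference, so each can be bounded separately.\<close>
  have "cinner (G x) (\<i> *\<^sub>C y) + cinner (G (\<i> *\<^sub>C y)) x = (- \<i>) * (cinner (G x) y - cinner (G y) x)"
    by (simp add: bounded_op_simps[OF G] cinner_simps algebra_simps)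
  then have 2: "cmod (cinner (G x) y - cinner (G y) x) \<le> B"
    using sym[of "\<i> *\<^sub>C y"] by (simp add: B_def norm_scaleC norm_mult)
  have "2 * cinner (G x) y = (cinner (G x) y + cinner (G y) x) + (cinner (G x) y - cinner (G y) x)"
    by simp
  then have "cmod (2 * cinner (G x) y) \<le> B + B" using 1 2 by (metis norm_triangle_mono)
  then have "cmod (cinner (G x) y) \<le> B" by (simp add: norm_mult)
  then show "cmod (cinner (G x) y) \<le> E x y" by (simp only: E_def B_def r_def)
  have "2 * cinner (G y) x = (cinner (G x) y + cinner (G y) x) - (cinner (G x) y - cinner (G y) x)"
    by simp
  then have "cmod (2 * cinner (G y) x) \<le> B + B"
    using 1 2 by (metis add_mono norm_triangle_ineq4 order_trans)
  then have "cmod (cinner (G y) x) \<le> B" by (simp add: norm_mult)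
  then show "cmod (cinner (G y) x) \<le> E x y" by (simp only: E_def B_def r_def)
qed

text \<open>The hypothesis places the numerical range in a sector of opening less than pi with
  vertex \<open>l\<close>. Then d (l - A) is sectorial, and a unit vector whose value is close to
  \<open>l\<close> nearly annihilates it together with its adjoint.\<close>

lemma corner_reducing_approx_eigenvalue:
  assumes A: "bounded_op A" and l: "l \<in> closure (numerical_range A)" and d: "d \<noteq> 0" and tau: "\<tau> > 0"
    and sec: "\<And>w. w \<in> numerical_range A \<Longrightarrow> \<tau> * \<bar>Im (d * (l - w))\<bar> \<le> Re (d * (l - w))"
  shows "reducing_approx_eigenvalue A l"
  unfolding reducing_approx_eigenvalue_def
proof (intro allI impI)
  fix \<epsilon> :: real assume eps: "\<epsilon> > 0"
  define G where "G = (\<lambda>x. (- d) *\<^sub>C (A x - l *\<^sub>C x))"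
  have G: "bounded_op G" unfolding G_def by (intro bounded_op_scale bounded_op_shift A)
  obtain K where K: "K > 0" "\<And>x. norm (G x) \<le> K * norm x"
    using bounded_op_bound[OF G] by blast
  have Gc: "cinner (G x) y = - d * (cinner (A x) y - l * cinner x y)" for x y
    by (simp add: G_def cinner_simps)
  have Im_mult: "Im (of_real r * v) = r * Im v" and Re_mult: "Re (of_real r * v) = r * Re v"
    for r v by simp_all
  have secG: "\<tau> * \<bar>Im (cinner (G x) x)\<bar> \<le> Re (cinner (G x) x)" for x
  proof (cases "x = 0")
    case False
    define w where "w = cinner (A x) x / of_real ((norm x)\<^sup>2)"
    have "cinner (G x) x = of_real ((norm x)\<^sup>2) * (d * (l - w))"
      using False by (simp add: Gc w_def cinner_self field_simps)
    then have "Im (cinner (G x) x) = (norm x)\<^sup>2 * Im (d * (l - w))"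
      "Re (cinner (G x) x) = (norm x)\<^sup>2 * Re (d * (l - w))"
      by (simp_all only: Im_mult Re_mult)
    moreover have "\<tau> * \<bar>Im (d * (l - w))\<bar> \<le> Re (d * (l - w))"
      by (rule sec) (use numerical_range_memI'[OF A False] in \<open>simp add: w_def\<close>)
    from mult_left_mono[OF this zero_le_power2[of "norm x"]]
    have "\<tau> * ((norm x)\<^sup>2 * \<bar>Im (d * (l - w))\<bar>) \<le> (norm x)\<^sup>2 * Re (d * (l - w))"
      by (simp only: mult_ac)
    ultimately show ?thesis
      by (simp only: abs_mult abs_power2)
  qed (simp add: G)
  \<comment> \<open>\<open>c\<close> is the largest root that keeps the bound of
    \<open>sectorial_form_bound\<close> at \<open>cmod d * \<epsilon>\<close>; \<open>\<eta>\<close>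
    is then the distance from \<open>l\<close> for which that root is at most
    \<open>c\<close>.\<close>
  define c where "c = \<epsilon> * cmod d / ((1 + 1 / \<tau>) * 4)"
  have c0: "c > 0" using eps d tau by (simp add: c_def add_pos_pos)
  define \<eta> where "\<eta> = c\<^sup>2 / (K * cmod d)"
  have eta: "\<eta> > 0" using c0 K d by (simp add: \<eta>_def)
  obtain w where w: "w \<in> numerical_range A" "dist w l < \<eta>"
    using l eta by (meson closure_approachable)
  then obtain e where e: "norm e = 1" "w = cinner (A e) e" by (auto simp: numerical_range_def)
  have "Re (cinner (G e) e) \<le> cmod (cinner (G e) e)" by (rule complex_Re_le_cmod)
  also have "\<dots> = cmod d * dist w l"
    using e by (simp add: Gc cinner_self norm_mult dist_norm)
  also have "\<dots> \<le> cmod d * \<eta>" using w by (intro mult_left_mono) auto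
  finally have "K * Re (cinner (G e) e) \<le> K * (cmod d * \<eta>)" using K by simp
  also have "\<dots> = c\<^sup>2" using K d by (simp add: \<eta>_def)
  finally have sq: "sqrt (K * Re (cinner (G e) e)) \<le> c" using c0 by (simp add: real_le_lsqrt)
  have small: "(1 + 1 / \<tau>) * (4 * sqrt (K * Re (cinner (G e) e)) * norm z) \<le> cmod d * (\<epsilon> * norm z)" for z
  proof -
    have "(1 + 1 / \<tau>) * (4 * sqrt (K * Re (cinner (G e) e)) * norm z) \<le> (1 + 1 / \<tau>) * (4 * c * norm z)"
      using tau sq by (intro mult_left_mono mult_right_mono) auto
    also have "\<dots> = cmod d * (\<epsilon> * norm z)"
    proof -
      have "(1 + 1 / \<tau>) * 4 \<noteq> 0" using tau by (simp add: add_pos_pos pos_add_strict less_imp_neq[symmetric])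
      then have "(1 + 1 / \<tau>) * 4 * c = \<epsilon> * cmod d" by (simp add: c_def)
      then show ?thesis by (simp add: mult_ac)
    qed
    finally show ?thesis .
  qed
  have "cmod (cinner (A e) z - l * cinner e z) \<le> \<epsilon> * norm z" for z
    using order_trans[OF sectorial_form_bound(1)[OF G K tau secG] small[of z]] d
    by (simp add: Gc norm_mult)
  moreover have "cmod (cinner (A z) e - l * cinner z e) \<le> \<epsilon> * norm z" for z
    using order_trans[OF sectorial_form_bound(2)[OF G K tau secG] small[of z]] d
    by (simp add: Gc norm_mult)
  ultimately show "\<exists>e. norm e = 1 \<and>
       (\<forall>z. cmod (cinner (A e) z - l * cinner e z) \<le> \<epsilon> * norm z \<and>
            cmod (cinner (A z) e - l * cinner z e) \<le> \<epsilon> * norm z)"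
    using e(1) by blast
qed

section \<open>Rank one operators\<close>

text \<open>
  The numerical range of \<open>z \<mapsto> \<langle>z, y\<rangle> x\<close> consists of the products \<open>\<langle>x, u\<rangle> \<langle>u, y\<rangle>\<close>; it is the
  elliptical disc with foci \<open>0\<close>, \<open>\<langle>x, y\<rangle>\<close> and major axis \<open>\<parallel>x\<parallel> \<parallel>y\<parallel>\<close>.
\<close>

lemma rank_one_ellipse:
  fixes x y u :: "'a::complex_hilbert"
  assumes u: "norm u = 1"
  shows "cmod (cinner x u * cinner u y) + cmod (cinner x u * cinner u y - cinner x y) \<le> norm x * norm y"
proof -
  define P where "P = (\<lambda>x::'a. x - cinner x u *\<^sub>C u)"
  have uu: "cinner u u = 1" using u by (simp add: cinner_self)
  \<comment> \<open>Split \<open>x\<close> and \<open>y\<close> into components along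
    \<open>u\<close> and orthogonal to it: the two moduli are bounded by the products of the
    respective component norms, and Lagrange's identity in the plane gives the rest.\<close>
  have pyth: "(norm x)\<^sup>2 = (cmod (cinner x u))\<^sup>2 + (norm (P x))\<^sup>2" for x
  proof -
    have "cinner (P x) (P x) = cinner x x - cinner x u * cinner u x"
      using cinner_commute[of u x] by (simp add: P_def cinner_simps uu algebra_simps)
    also have "cinner x u * cinner u x = of_real ((cmod (cinner x u))\<^sup>2)"
      by (metis cinner_commute complex_norm_square of_real_power)
    finally have "complex_of_real ((norm (P x))\<^sup>2) = of_real ((norm x)\<^sup>2 - (cmod (cinner x u))\<^sup>2)"
      by (simp add: cinner_self)
    then show ?thesis by (simp only: of_real_eq_iff)
  qed
  have "cinner (P x) (P y) = cinner x y - cinner x u * cinner u y"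
    using cinner_commute[of u y] by (simp add: P_def cinner_simps uu algebra_simps)
  then have "cmod (cinner x u * cinner u y - cinner x y) \<le> norm (P x) * norm (P y)"
    using norm_cinner_le[of "P x" "P y"] by (simp add: norm_minus_commute)
  moreover have "cmod (cinner u y) = cmod (cinner y u)"
    by (metis cinner_commute complex_mod_cnj)
  ultimately have "cmod (cinner x u * cinner u y) + cmod (cinner x u * cinner u y - cinner x y)
      \<le> cmod (cinner x u) * cmod (cinner y u) + norm (P x) * norm (P y)"
    by (simp add: norm_mult)
  also have "\<dots> \<le> norm x * norm y"
  proof (rule power2_le_imp_le)
    have "(cmod (cinner x u) * cmod (cinner y u) + norm (P x) * norm (P y))\<^sup>2
       + (cmod (cinner x u) * norm (P y) - norm (P x) * cmod (cinner y u))\<^sup>2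
       = (norm x)\<^sup>2 * (norm y)\<^sup>2"
      unfolding pyth[of x] pyth[of y] by (simp add: power2_eq_square algebra_simps)
    then show "(cmod (cinner x u) * cmod (cinner y u) + norm (P x) * norm (P y))\<^sup>2 \<le> (norm x * norm y)\<^sup>2"
      by (metis le_add_same_cancel1 power_mult_distrib zero_le_power2)
  qed simp
  finally show ?thesis .
qed

text \<open>Lagrangian form of the support function of an elliptical disc with foci \<open>0\<close> and \<open>c\<close>.\<close>

lemma ellipse_support:
  fixes b c z :: complex
  assumes b: "cmod b + cmod (b - c) \<le> N" and L: "L \<ge> 0"
    and z: "(cmod z)\<^sup>2 \<le> 2 * L * Re (z * c) + L\<^sup>2 * (N\<^sup>2 - (cmod c)\<^sup>2)"
  shows "Re (z * b) \<le> Re (z * c) + L * (N\<^sup>2 - (cmod c)\<^sup>2) / 2"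
proof -
  define g where "g = b - c"
  have N0: "N \<ge> 0" using b norm_ge_zero[of b] norm_ge_zero[of "b - c"] by linarith
  have "(cmod (g + c))\<^sup>2 \<le> (N - cmod g)\<^sup>2"
    using b by (intro power_mono) (auto simp: g_def)
  moreover have "(cmod (g + c))\<^sup>2 = (cmod g)\<^sup>2 + 2 * Re (cnj c * g) + (cmod c)\<^sup>2"
    unfolding cmod_power2 by (simp add: power2_eq_square algebra_simps)
  ultimately have 1: "N * cmod g + Re (cnj c * g) \<le> (N\<^sup>2 - (cmod c)\<^sup>2) / 2"
    by (simp add: power2_eq_square algebra_simps)
  \<comment> \<open>The hypothesis on \<open>z\<close> is precisely the square of the bound proved
    here.\<close>
  have "(cmod (z - of_real L * cnj c))\<^sup>2 = (cmod z)\<^sup>2 - 2 * L * Re (z * c) + L\<^sup>2 * (cmod c)\<^sup>2"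
    unfolding cmod_power2 by (simp add: power2_eq_square algebra_simps)
  also have "\<dots> \<le> (L * N)\<^sup>2"
    using z by (simp add: power_mult_distrib algebra_simps)
  finally have 2: "cmod (z - of_real L * cnj c) \<le> L * N"
    by (rule power2_le_imp_le) (use L N0 in simp)
  have "Re (z * g) = Re ((z - of_real L * cnj c) * g) + L * Re (cnj c * g)"
    by (simp add: algebra_simps)
  also have "Re ((z - of_real L * cnj c) * g) \<le> cmod (z - of_real L * cnj c) * cmod g"
    by (metis complex_Re_le_cmod norm_mult)
  also have "\<dots> \<le> L * N * cmod g" by (intro mult_right_mono 2) auto
  also have "L * N * cmod g + L * Re (cnj c * g) = L * (N * cmod g + Re (cnj c * g))"
    by (simp add: algebra_simps)
  also have "\<dots> \<le> L * ((N\<^sup>2 - (cmod c)\<^sup>2) / 2)" by (intro mult_left_mono 1 L)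
  finally have "Re (z * g) \<le> L * (N\<^sup>2 - (cmod c)\<^sup>2) / 2" by simp
  moreover have "Re (z * b) = Re (z * g) + Re (z * c)" by (simp add: g_def algebra_simps)
  ultimately show ?thesis by simp
qed

text \<open>A version without sign or size conditions on \<open>z\<close>, at the price of an error
  of order sqrt \<open>\<delta>\<close>. That is good enough for the points of S other than 1, which
  have room to spare.\<close>

lemma ellipse_support_crude:
  fixes b c z :: complex
  assumes b: "cmod b + cmod (b - c) \<le> N" and N: "N\<^sup>2 - (cmod c)\<^sup>2 \<le> \<delta>" and \<delta>: "\<delta> > 0"
  shows "Re (z * b) \<le> max 0 (Re (z * c)) + cmod z * sqrt \<delta> / 2"
proof -
  \<comment> \<open>Enlarging the ellipse until the difference of squares equals
    \<open>\<delta>\<close> makes it positive, so it can be divided by.\<close>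
  define N' where "N' = sqrt ((cmod c)\<^sup>2 + \<delta>)"
  have N'2: "N'\<^sup>2 = (cmod c)\<^sup>2 + \<delta>" using \<delta> by (simp add: N'_def)
  have "N \<le> N'" unfolding N'_def by (rule real_le_rsqrt) (use N in simp)
  then have b': "cmod b + cmod (b - c) \<le> N'" using b by simp
  define q where "q = Re (z * c)"
  define s where "s = cmod z * sqrt \<delta>"
  have s0: "s \<ge> 0" "s\<^sup>2 = (cmod z)\<^sup>2 * \<delta>" using \<delta> by (simp_all add: s_def power_mult_distrib)
  \<comment> \<open>With this choice \<open>(L * \<delta>) * (2 * q + L * \<delta>)\<close> factors
    as the difference of the squares of \<open>\<bar>q\<bar> + s\<close> and \<open>q\<close>, and
    \<open>q + L * \<delta> / 2\<close> becomes \<open>max 0 q + s / 2\<close>.\<close>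
  define L where "L = (\<bar>q\<bar> - q + s) / \<delta>"
  have L0: "L \<ge> 0" using \<delta> s0 by (simp add: L_def)
  have Ld: "L * \<delta> = \<bar>q\<bar> - q + s" using \<delta> by (simp add: L_def)
  have "(2 * L * q + L\<^sup>2 * \<delta>) * \<delta> = (L * \<delta>) * (2 * q + L * \<delta>)"
    by (simp add: power2_eq_square algebra_simps)
  also have "\<dots> = s\<^sup>2 + 2 * \<bar>q\<bar> * s"
    unfolding Ld by (simp add: power2_eq_square algebra_simps)
  also have "\<dots> \<ge> (cmod z)\<^sup>2 * \<delta>" using s0 by simp
  finally have "(cmod z)\<^sup>2 \<le> 2 * L * q + L\<^sup>2 * \<delta>" using \<delta> by simp
  then have "Re (z * b) \<le> q + L * \<delta> / 2"
    using ellipse_support[OF b' L0, of z] by (simp add: N'2 q_def)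
  also have "\<dots> = max 0 q + s / 2" unfolding Ld by (simp add: max_def abs_if field_simps)
  finally show ?thesis by (simp add: q_def s_def)
qed

text \<open>The content of (A3) for B z = \<open>cinner z y *\<^sub>C x\<close>: the number
  \<open>cinner (A x) y\<close> is an eigenvalue of AB, and the set under the closure is
  W(A)W(B).\<close>

definition rank_one_condition :: "('a::complex_hilbert \<Rightarrow> 'a) \<Rightarrow> bool" where
  "rank_one_condition A \<longleftrightarrow> (\<forall>x y. x \<noteq> 0 \<longrightarrow> y \<noteq> 0 \<longrightarrow>
     cinner (A x) y \<in> closure {a * (cinner x u * cinner u y) |a u. a \<in> numerical_range A \<and> norm u = 1})"

lemma rank_one_conditionI:
  assumes A: "bounded_op A"
    and A3: "\<And>B. rank_one_op B \<Longrightarrow> spectrum (A \<circ> B) \<subseteq> closure (numerical_range A * numerical_range B)"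
  shows "rank_one_condition A"
  unfolding rank_one_condition_def
proof (intro allI impI)
  fix x y :: 'a assume x: "x \<noteq> 0" and y: "y \<noteq> 0"
  define B where "B = (\<lambda>z. cinner z y *\<^sub>C x)"
  have "norm (cinner z y *\<^sub>C x) \<le> (norm y * norm x) * norm z" for z
    using mult_right_mono[OF norm_cinner_le[of z y] norm_ge_zero[of x]]
    by (simp add: norm_scaleC mult_ac)
  then have B: "bounded_op B"
    unfolding B_def
    by (intro bounded_opI) (auto simp: cinner_simps scaleC_left_distrib scaleC_scaleC)
  have "range B = complex_vector.span {x}"
  proof
    show "range B \<subseteq> complex_vector.span {x}"
      by (auto simp: B_def intro: complex_vector.span_scale complex_vector.span_base)
    show "complex_vector.span {x} \<subseteq> range B"
    proof
      fix v assume "v \<in> complex_vector.span {x}"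
      then obtain k where v: "v = k *\<^sub>C x"
        by (auto simp: complex_vector.span_singleton)
      have "B ((k / of_real ((norm y)\<^sup>2)) *\<^sub>C y) = v"
        using y by (simp add: B_def v cinner_simps cinner_self)
      then show "v \<in> range B" by blast
    qed
  qed
  moreover have "complex_vector.dim (complex_vector.span {x}) = 1"
    using complex_vector.dim_span_eq_card_independent[of "{x}"] x
    by (simp add: complex_vector.dependent_single)
  ultimately have "rank_one_op B" using B by (simp add: rank_one_op_def)
  note sub = A3[OF this]
  have mem: "cinner (A x) y \<in> spectrum (A \<circ> B)"
  proof -
    define T where "T = (\<lambda>z. (A \<circ> B) z - cinner (A x) y *\<^sub>C z)"
    \<comment> \<open>\<open>A x\<close> is an eigenvector of AB when nonzero; otherwise the
      eigenvalue is 0 and \<open>x\<close> itself lies in the kernel of AB.\<close>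
    define v where "v = (if A x = 0 then x else A x)"
    have "T v = 0"
      by (simp add: T_def v_def B_def bounded_op_simps[OF A])
    moreover have "T 0 = 0" by (simp add: T_def B_def A)
    moreover have "v \<noteq> 0" using x by (simp add: v_def)
    ultimately have "\<not> inj T" by (metis injD)
    then have "\<not> invertible_op T"
      unfolding invertible_op_def by (metis inj_on_id inj_on_imageI2)
    then show ?thesis by (simp add: spectrum_def T_def)
  qed
  have "numerical_range B = {cinner x u * cinner u y |u. norm u = 1}"
    unfolding numerical_range_def B_def cinner_simps by (simp only: mult.commute)
  then have eq: "numerical_range A * numerical_range B
     = {a * (cinner x u * cinner u y) |a u. a \<in> numerical_range A \<and> norm u = 1}"
    by (fastforce simp: set_times_def)
  show "cinner (A x) y \<in> closure {a * (cinner x u * cinner u y) |a u. a \<in> numerical_range A \<and> norm u = 1}"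
    using subsetD[OF sub mem] unfolding eq .
qed

lemma rank_one_condition_support:
  assumes A: "rank_one_condition A" and xy: "x \<noteq> 0" "y \<noteq> 0"
    and M: "\<And>a u. a \<in> numerical_range A \<Longrightarrow> norm u = 1 \<Longrightarrow> Re (d * a * (cinner x u * cinner u y)) \<le> M"
  shows "Re (d * cinner (A x) y) \<le> M"
proof -
  have "closure {a * (cinner x u * cinner u y) |a u. a \<in> numerical_range A \<and> norm u = 1} \<subseteq> {w. Re (d * w) \<le> M}"
  proof (rule closure_minimal)
    show "closed {w. Re (d * w) \<le> M}"
      by (intro closed_Collect_le continuous_intros)
  qed (use M in \<open>auto simp: mult.assoc\<close>)
  then show ?thesis using A xy unfolding rank_one_condition_def by blast
qed

lemma rank_one_condition_scale:
  assumes A: "rank_one_condition A"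
  shows "rank_one_condition (\<lambda>x. k *\<^sub>C A x)"
  unfolding rank_one_condition_def
proof (intro allI impI)
  fix x y :: 'a assume xy: "x \<noteq> 0" "y \<noteq> 0"
  let ?S = "{a * (cinner x u * cinner u y) |a u. a \<in> numerical_range A \<and> norm u = 1}"
  let ?S' = "{a * (cinner x u * cinner u y) |a u. a \<in> numerical_range (\<lambda>x. k *\<^sub>C A x) \<and> norm u = 1}"
  have "(*) k ` ?S \<subseteq> ?S'"
  proof clarify
    fix a u assume a: "a \<in> numerical_range A" and u: "norm (u::'a) = 1"
    have "k * a \<in> numerical_range (\<lambda>x. k *\<^sub>C A x)"
      using a by (auto simp: numerical_range_def cinner_simps)
    then show "\<exists>a' u'. k * (a * (cinner x u * cinner u y)) = a' * (cinner x u' * cinner u' y) \<and>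
        a' \<in> numerical_range (\<lambda>x. k *\<^sub>C A x) \<and> norm u' = 1"
      using u by (intro exI[of _ "k * a"] exI[of _ u]) (simp add: mult.assoc)
  qed
  moreover have "(*) k ` closure ?S \<subseteq> closure ((*) k ` ?S)"
    by (rule image_closure_subset) (auto intro: continuous_intros closure_subset[THEN subsetD])
  ultimately have "(*) k ` closure ?S \<subseteq> closure ?S'"
    by (meson closure_mono order_trans)
  moreover have "cinner (A x) y \<in> closure ?S"
    using A xy unfolding rank_one_condition_def by blast
  ultimately show "cinner (k *\<^sub>C A x) y \<in> closure ?S'"
    by (auto simp: cinner_simps)
qed

lemma convex_Re_mult_le: "convex {a. Re (c * a) \<le> M}"
proof -
  have "{a. Re (c * a) \<le> M} = {a. inner (cnj c) a \<le> M}"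
    by (simp add: inner_complex_def)
  then show ?thesis by (simp only: convex_halfspace_le)
qed

text \<open>A half-plane bound on W(A)W(B), passed to the limit along approximate eigenvectors. The
  first entry of the maximum is what the point 1 of \<open>S\<close> contributes, the second bounds
  all other points; convexity of the half-plane carries the bound from \<open>S\<close> to
  W(A).\<close>

lemma rank_one_condition_step:
  assumes A: "bounded_op A" and star: "rank_one_condition A"
    and WS: "numerical_range A \<subseteq> convex hull S" and S1: "\<And>a. a \<in> S \<Longrightarrow> cmod a \<le> 1"
    and r1: "reducing_approx_eigenvalue A 1" and rmu: "reducing_approx_eigenvalue A \<mu>" and mu: "\<mu> \<noteq> 1"
    and kap: "\<And>a. a \<in> S - {1} \<Longrightarrow> Re (d * a) \<le> 1 - \<kappa>"
    and zeta: "cmod \<zeta> = 1" and eps: "\<epsilon> > 0" and pos: "Re (d * (1 + of_real \<epsilon> * \<zeta>)) > 0"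
  shows "Re (d * (1 + of_real \<epsilon> * \<zeta> * \<mu>)) \<le>
    max (Re (d * (1 + of_real \<epsilon> * \<zeta>)) +
           (cmod d)\<^sup>2 * (2 * \<epsilon> * (1 - Re \<zeta>)) / (4 * Re (d * (1 + of_real \<epsilon> * \<zeta>))))
        (max 0 (1 - \<kappa> + cmod d * (2 * \<epsilon>)) + cmod d * sqrt (5 * \<epsilon>) / 2)"
    (is "_ \<le> max _ ?B2")
proof -
  define \<eta> where "\<eta> = (\<lambda>n. 1 / real (Suc n))"
  have eta: "\<eta> n > 0" for n by (simp add: \<eta>_def)
  have eta_lim: "\<eta> \<longlonglongrightarrow> 0"
    using LIMSEQ_inverse_real_of_nat by (simp add: \<eta>_def inverse_eq_divide)
  have "\<exists>e. norm e = 1 \<and> (\<forall>z. cmod (cinner (A e) z - cinner e z) \<le> \<eta> n * norm z \<and>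
            cmod (cinner (A z) e - cinner z e) \<le> \<eta> n * norm z)" for n
    using r1 eta[of n] unfolding reducing_approx_eigenvalue_def by auto
  then obtain e where e1: "\<And>n. norm (e n) = 1"
    and e2: "\<And>n z. cmod (cinner (A (e n)) z - cinner (e n) z) \<le> \<eta> n * norm z"
    and e3: "\<And>n z. cmod (cinner (A z) (e n) - cinner z (e n)) \<le> \<eta> n * norm z"
    by metis
  have "\<exists>v. norm v = 1 \<and> (\<forall>z. cmod (cinner (A v) z - \<mu> * cinner v z) \<le> \<eta> n * norm z \<and>
            cmod (cinner (A z) v - \<mu> * cinner z v) \<le> \<eta> n * norm z)" for n
    using rmu eta[of n] unfolding reducing_approx_eigenvalue_def by blast
  then obtain v where v1: "\<And>n. norm (v n) = 1"
    and v2: "\<And>n z. cmod (cinner (A (v n)) z - \<mu> * cinner (v n) z) \<le> \<eta> n * norm z"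
    and v3: "\<And>n z. cmod (cinner (A z) (v n) - \<mu> * cinner z (v n)) \<le> \<eta> n * norm z"
    by metis
  have null: "X \<longlonglongrightarrow> l" if "\<And>n. cmod (X n - l) \<le> C * \<eta> n" for X l C
  proof -
    have "(\<lambda>n. C * \<eta> n) \<longlonglongrightarrow> 0"
      using tendsto_mult[OF tendsto_const eta_lim, of C] by simp
    then have "(\<lambda>n. X n - l) \<longlonglongrightarrow> 0"
      by (rule Lim_null_comparison[rotated]) (use that in simp)
    then show ?thesis by (simp add: LIM_zero_cancel)
  qed
  define \<alpha> where "\<alpha> = (\<lambda>n. cinner (e n) (v n))"
  \<comment> \<open>Approximate eigenvectors for different values are asymptotically orthogonal:
    \<open>cinner (A e) v\<close> is close to both \<open>cinner e v\<close> and
    \<open>\<mu> * cinner e v\<close>, the latter because \<open>v\<close> is reducing.\<close>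
  have alpha: "\<alpha> \<longlonglongrightarrow> 0"
  proof (rule null[of _ _ "2 / cmod (1 - \<mu>)"])
    fix n
    have "(1 - \<mu>) * \<alpha> n = (cinner (A (e n)) (v n) - \<mu> * cinner (e n) (v n))
        - (cinner (A (e n)) (v n) - cinner (e n) (v n))"
      by (simp add: \<alpha>_def algebra_simps)
    also have "cmod \<dots> \<le> \<eta> n + \<eta> n"
      using e2[of n "v n"] v3[of "e n" n]
      by (intro order_trans[OF norm_triangle_ineq4 add_mono]) (simp_all only: e1 v1 mult_1_right)
    finally have "cmod (1 - \<mu>) * cmod (\<alpha> n) \<le> 2 * \<eta> n" by (simp add: norm_mult)
    then show "cmod (\<alpha> n - 0) \<le> 2 / cmod (1 - \<mu>) * \<eta> n" using mu by (simp add: field_simps)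
  qed
  have alpha': "cinner (v n) (e n) = cnj (\<alpha> n)" for n
    unfolding \<alpha>_def by (rule cinner_commute)
  have ee: "(\<lambda>n. cinner (A (e n)) (e n)) \<longlonglongrightarrow> 1"
    by (rule null[of _ _ 1]) (use e2[of n "e n" for n] in \<open>simp add: e1 cinner_self\<close>)
  have vv: "(\<lambda>n. cinner (A (v n)) (v n)) \<longlonglongrightarrow> \<mu>"
    by (rule null[of _ _ 1]) (use v2[of n "v n" for n] in \<open>simp add: v1 cinner_self\<close>)
  have "(\<lambda>n. cinner (A (e n)) (v n) - \<alpha> n) \<longlonglongrightarrow> 0"
    by (rule null[of _ _ 1]) (use e2[of n "v n" for n] in \<open>simp add: v1 \<alpha>_def\<close>)
  from tendsto_add[OF this alpha] have ev: "(\<lambda>n. cinner (A (e n)) (v n)) \<longlonglongrightarrow> 0" by simp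
  have "(\<lambda>n. cinner (A (v n)) (e n) - cnj (\<alpha> n)) \<longlonglongrightarrow> 0"
    by (rule null[of _ _ 1]) (use e3[of "v n" n for n] in \<open>simp add: v1 alpha'\<close>)
  from tendsto_add[OF this tendsto_cnj[OF alpha]]
  have ve: "(\<lambda>n. cinner (A (v n)) (e n)) \<longlonglongrightarrow> 0" by simp
  have alpha'': "cinner (e n) (v n) = \<alpha> n" for n
    by (simp add: \<alpha>_def)
  define s where "s = complex_of_real (sqrt \<epsilon>)"
  define p where "p = of_real \<epsilon> * \<zeta>"
  have ss: "s * s = of_real \<epsilon>" "cnj s = s"
    using eps by (simp_all add: s_def flip: of_real_mult)
  have zz: "\<zeta> * cnj \<zeta> = 1" using zeta by (simp add: complex_norm_square[symmetric])
  \<comment> \<open>Equal moduli sqrt \<open>\<epsilon>\<close> put the whole phase into the product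
    \<open>s * cnj t = p\<close>; the squared norms of \<open>x n\<close> and \<open>y n\<close>
    both tend to 1 + \<open>\<epsilon>\<close>.\<close>
  define t where "t = s * cnj \<zeta>"
  have st: "cnj t = s * \<zeta>" "s * cnj t = p" "s * cnj s = of_real \<epsilon>" "t * cnj t = of_real \<epsilon>"
  proof -
    show c: "cnj t = s * \<zeta>" by (simp add: t_def ss)
    show "s * cnj t = p" unfolding c mult.assoc[symmetric] ss p_def ..
    show "s * cnj s = of_real \<epsilon>" by (simp add: ss)
    have "t * cnj t = (s * s) * (\<zeta> * cnj \<zeta>)" unfolding c by (simp add: t_def)
    then show "t * cnj t = of_real \<epsilon>" by (simp add: ss zz)
  qed
  have expand: "cinner (e n + a *\<^sub>C v n) (e n + b *\<^sub>C v n)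
      = 1 + a * cnj b + a * cnj (\<alpha> n) + cnj b * \<alpha> n" for a b n
    by (simp add: cinner_simps cinner_self e1 v1 alpha' alpha'' algebra_simps)
  define x where "x = (\<lambda>n. e n + s *\<^sub>C v n)"
  define y where "y = (\<lambda>n. e n + t *\<^sub>C v n)"
  define c where "c = (\<lambda>n. cinner (x n) (y n))"
  define N where "N = (\<lambda>n. norm (x n) * norm (y n))"
  have c_eq: "c n = 1 + s * cnj (\<alpha> n) + s * \<zeta> * \<alpha> n + p" for n
    unfolding c_def x_def y_def expand st(2-4) unfolding st(1) by simp
  have c_lim: "c \<longlonglongrightarrow> 1 + p"
    unfolding c_eq by (rule tendsto_eq_intros alpha refl | simp)+
  have Axy_eq: "cinner (A (x n)) (y n) = cinner (A (e n)) (e n) + s * cinner (A (v n)) (e n)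
      + s * \<zeta> * cinner (A (e n)) (v n) + p * cinner (A (v n)) (v n)" for n
    unfolding x_def y_def st(1,2)[symmetric]
    by (simp add: bounded_op_simps[OF A] cinner_simps algebra_simps)
  have Axy_lim: "(\<lambda>n. cinner (A (x n)) (y n)) \<longlonglongrightarrow> 1 + p * \<mu>"
    unfolding Axy_eq by (rule tendsto_eq_intros ee vv ev ve refl | simp)+
  have "complex_of_real ((norm (x n))\<^sup>2) = 1 + of_real \<epsilon> + s * cnj (\<alpha> n) + s * \<alpha> n" for n
    unfolding cinner_self[symmetric] x_def expand st(2-4) ss by simp
  then have nx: "(norm (x n))\<^sup>2 = Re (1 + of_real \<epsilon> + s * cnj (\<alpha> n) + s * \<alpha> n)" for n
    by (metis Re_complex_of_real)
  have "complex_of_real ((norm (y n))\<^sup>2) = 1 + of_real \<epsilon> + s * cnj \<zeta> * cnj (\<alpha> n) + s * \<zeta> * \<alpha> n" for n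
    unfolding cinner_self[symmetric] y_def expand st(2-4) unfolding st(1) by (simp add: t_def)
  then have ny: "(norm (y n))\<^sup>2 = Re (1 + of_real \<epsilon> + s * cnj \<zeta> * cnj (\<alpha> n) + s * \<zeta> * \<alpha> n)" for n
    by (metis Re_complex_of_real)
  have nx_lim: "(\<lambda>n. (norm (x n))\<^sup>2) \<longlonglongrightarrow> 1 + \<epsilon>"
    unfolding nx by (rule tendsto_eq_intros alpha refl | simp)+
  have ny_lim: "(\<lambda>n. (norm (y n))\<^sup>2) \<longlonglongrightarrow> 1 + \<epsilon>"
    unfolding ny by (rule tendsto_eq_intros alpha refl | simp)+
  \<comment> \<open>The squared minor axis of the ellipse containing the numerical range of the rank
    one operator.\<close>
  define \<delta> where "\<delta> = (\<lambda>n. (N n)\<^sup>2 - (cmod (c n))\<^sup>2)"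
  have "(\<lambda>n. (norm (x n))\<^sup>2 * (norm (y n))\<^sup>2 - (cmod (c n))\<^sup>2) \<longlonglongrightarrow> (1 + \<epsilon>) * (1 + \<epsilon>) - (cmod (1 + p))\<^sup>2"
    by (intro tendsto_intros nx_lim ny_lim c_lim)
  moreover have "(cmod (1 + p))\<^sup>2 = 1 + 2 * \<epsilon> * Re \<zeta> + \<epsilon>\<^sup>2"
  proof -
    have "(cmod (1 + p))\<^sup>2 = 1 + 2 * Re p + (cmod p)\<^sup>2"
      unfolding cmod_power2 by (simp add: power2_eq_square algebra_simps)
    then show ?thesis using zeta by (simp add: p_def norm_mult)
  qed
  ultimately have d_lim: "\<delta> \<longlonglongrightarrow> 2 * \<epsilon> * (1 - Re \<zeta>)"
    by (simp add: \<delta>_def N_def power_mult_distrib power2_eq_square algebra_simps)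
  have d0: "\<delta> n \<ge> 0" for n
    using power_mono[OF norm_cinner_le[of "x n" "y n"], of 2] by (simp add: \<delta>_def N_def c_def)
  have Rez: "- 1 \<le> Re \<zeta>" using abs_Re_le_cmod[of \<zeta>] zeta by simp
  \<comment> \<open>The limit is at most 4 \<open>\<epsilon>\<close>; the constant 5 leaves room for
    a strict inequality that holds eventually.\<close>
  have "2 * \<epsilon> * (1 - Re \<zeta>) < 5 * \<epsilon>"
  proof -
    have "2 * \<epsilon> * (1 - Re \<zeta>) \<le> 2 * \<epsilon> * 2" using eps Rez by (intro mult_left_mono) auto
    then show ?thesis using eps by simp
  qed
  then have ev1: "eventually (\<lambda>n. \<delta> n < 5 * \<epsilon>) sequentially"
    by (rule order_tendstoD(2)[OF d_lim])
  have "(\<lambda>n. cmod (c n - 1)) \<longlonglongrightarrow> \<epsilon>"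
    by (rule tendsto_eq_intros c_lim refl)+ (use eps zeta in \<open>simp add: p_def norm_mult\<close>)
  then have ev2: "eventually (\<lambda>n. cmod (c n - 1) < 2 * \<epsilon>) sequentially"
    using eps by (intro order_tendstoD(2)[of _ \<epsilon>]) auto
  have Re_lim: "(\<lambda>n. Re (d * c n)) \<longlonglongrightarrow> Re (d * (1 + p))"
    by (intro tendsto_intros c_lim)
  then have ev3: "eventually (\<lambda>n. Re (d * c n) > 0) sequentially"
    using pos by (intro order_tendstoD(1)) (auto simp: p_def)
  define B1 where "B1 = (\<lambda>n. Re (d * c n) + (cmod d)\<^sup>2 * \<delta> n / (4 * Re (d * c n)))"
  have "eventually (\<lambda>n. Re (d * cinner (A (x n)) (y n)) \<le> max (B1 n) ?B2) sequentially"
    using ev1 ev2 ev3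
  proof eventually_elim
    case (elim n)
    have xy: "x n \<noteq> 0" "y n \<noteq> 0" using elim(3) by (auto simp: c_def)
    show ?case
    proof (rule rank_one_condition_support[OF star xy])
      fix a u assume a: "a \<in> numerical_range A" and u: "norm (u::'a) = 1"
      define b where "b = cinner (x n) u * cinner u (y n)"
      have bN: "cmod b + cmod (b - c n) \<le> N n"
        unfolding b_def c_def N_def by (rule rank_one_ellipse[OF u])
      have "S \<subseteq> {a. Re (d * a * b) \<le> max (B1 n) ?B2}"
      proof clarify
        fix a assume aS: "a \<in> S"
        show "Re (d * a * b) \<le> max (B1 n) ?B2"
        proof (cases "a = 1")
          case True
          \<comment> \<open>For this \<open>L\<close> the linear term alone satisfies the hypothesis
            of \<open>ellipse_support\<close>, and the resulting error is of first order in
            \<open>\<delta> n\<close>.\<close>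
          define L where "L = (cmod d)\<^sup>2 / (2 * Re (d * c n))"
          have "L \<ge> 0" using elim(3) by (simp add: L_def)
          have "D = 2 * (D / (2 * r)) * r" "D / (2 * r) * h / 2 = D * h / (4 * r)" if "r > 0" for D r h :: real
            using that by simp_all
          from this[OF elim(3)] have L: "(cmod d)\<^sup>2 = 2 * L * Re (d * c n)"
            "L * \<delta> n / 2 = (cmod d)\<^sup>2 * \<delta> n / (4 * Re (d * c n))"
            unfolding L_def by blast+
          have "0 \<le> L\<^sup>2 * ((N n)\<^sup>2 - (cmod (c n))\<^sup>2)" using d0[of n] by (simp add: \<delta>_def)
          with L(1) have "(cmod d)\<^sup>2 \<le> 2 * L * Re (d * c n) + L\<^sup>2 * ((N n)\<^sup>2 - (cmod (c n))\<^sup>2)"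
            by linarith
          from ellipse_support[OF bN \<open>L \<ge> 0\<close> this]
          have "Re (d * b) \<le> B1 n" unfolding B1_def L(2)[symmetric] by (simp only: \<delta>_def)
          then show ?thesis using True by simp
        next
          case False
          have "Re (d * a * c n) = Re (d * a) + Re (d * a * (c n - 1))" by (simp add: algebra_simps)
          also have "Re (d * a * (c n - 1)) \<le> cmod d * (2 * \<epsilon>)"
          proof -
            have "Re (d * a * (c n - 1)) \<le> cmod d * (cmod a * cmod (c n - 1))"
              by (metis complex_Re_le_cmod norm_mult mult.assoc)
            also have "\<dots> \<le> cmod d * (1 * (2 * \<epsilon>))"
              using S1[OF aS] elim(2) by (intro mult_left_mono mult_mono) auto
            finally show ?thesis by simp
          qed
          also have "Re (d * a) \<le> 1 - \<kappa>" using kap aS False by simp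
          finally have 1: "Re (d * a * c n) \<le> 1 - \<kappa> + cmod d * (2 * \<epsilon>)" by simp
          have "Re (d * a * b) \<le> max 0 (Re (d * a * c n)) + cmod (d * a) * sqrt (5 * \<epsilon>) / 2"
            by (rule ellipse_support_crude[OF bN]) (use elim(1) eps in \<open>simp_all add: \<delta>_def\<close>)
          also have "\<dots> \<le> ?B2"
          proof (intro add_mono divide_right_mono mult_right_mono)
            show "cmod (d * a) \<le> cmod d"
              using S1[OF aS] by (simp add: norm_mult mult_left_le)
          qed (use 1 eps in auto)
          finally show ?thesis by simp
        qed
      qed
      moreover have "convex {a. Re (d * a * b) \<le> max (B1 n) ?B2}"
        using convex_Re_mult_le[of "d * b" "max (B1 n) ?B2"] by (simp only: mult_ac)
      ultimately have "convex hull S \<subseteq> {a. Re (d * a * b) \<le> max (B1 n) ?B2}"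
        by (rule hull_minimal)
      then show "Re (d * a * (cinner (x n) u * cinner u (y n))) \<le> max (B1 n) ?B2"
        using a WS by (auto simp: b_def)
    qed
  qed
  moreover have "(\<lambda>n. max (B1 n) ?B2) \<longlonglongrightarrow> max (Re (d * (1 + p)) +
           (cmod d)\<^sup>2 * (2 * \<epsilon> * (1 - Re \<zeta>)) / (4 * Re (d * (1 + p)))) ?B2"
    unfolding B1_def using pos by (intro tendsto_intros Re_lim d_lim) (auto simp: p_def)
  moreover have "(\<lambda>n. Re (d * cinner (A (x n)) (y n))) \<longlonglongrightarrow> Re (d * (1 + p * \<mu>))"
    by (intro tendsto_intros Axy_lim)
  ultimately have "Re (d * (1 + p * \<mu>)) \<le> max (Re (d * (1 + p)) +
           (cmod d)\<^sup>2 * (2 * \<epsilon> * (1 - Re \<zeta>)) / (4 * Re (d * (1 + p)))) ?B2"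
    by (intro tendsto_le[OF sequentially_bot])
  then show ?thesis by (simp only: p_def)
qed

text \<open>Letting \<open>\<epsilon> \<rightarrow> 0\<close> and optimising over the phase \<open>\<zeta>\<close>.\<close>

lemma rank_one_condition_disc:
  assumes A: "bounded_op A" and star: "rank_one_condition A"
    and WS: "numerical_range A \<subseteq> convex hull S" and S1: "\<And>a. a \<in> S \<Longrightarrow> cmod a \<le> 1"
    and r1: "reducing_approx_eigenvalue A 1" and rmu: "reducing_approx_eigenvalue A \<mu>" and mu: "\<mu> \<noteq> 1"
    and kap: "\<And>a. a \<in> S - {1} \<Longrightarrow> Re (d * a) \<le> 1 - \<kappa>" and kap0: "\<kappa> > 0" and d: "Re d = 1"
  shows "Re (d * \<mu>) \<le> 1 - (cmod (\<mu> - 1))\<^sup>2"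
proof -
  define D where "D = (cmod d)\<^sup>2"
  have D0: "D > 0" using d by (auto simp: D_def)
  define w where "w = d * (\<mu> - 1)"
  have *: "Re (\<zeta> * w) \<le> D * (1 - Re \<zeta>) / 2" if zeta: "cmod \<zeta> = 1" for \<zeta>
  proof -
    define B2 where "B2 = (\<lambda>\<epsilon>. max 0 (1 - \<kappa> + cmod d * (2 * \<epsilon>)) + cmod d * sqrt (5 * \<epsilon>) / 2)"
    define q where "q = (\<lambda>\<epsilon>. Re (d * (1 + of_real \<epsilon> * \<zeta>)))"
    have q_lim: "(q \<longlongrightarrow> 1) (at_right 0)"
      unfolding q_def using d by (auto intro!: tendsto_eq_intros)
    \<comment> \<open>As \<open>\<epsilon>\<close> tends to 0 the left side of the step inequality
      tends to 1 and the second entry of its maximum to \<open>max 0 (1 - \<kappa>) < 1\<close>, so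
      only the first entry survives.\<close>
    have "((\<lambda>\<epsilon>. Re (d * (1 + of_real \<epsilon> * \<zeta> * \<mu>)) - B2 \<epsilon>) \<longlongrightarrow> 1 - max 0 (1 - \<kappa>)) (at_right 0)"
      unfolding B2_def using d by (auto intro!: tendsto_eq_intros)
    then have ev2: "eventually (\<lambda>\<epsilon>. 0 < Re (d * (1 + of_real \<epsilon> * \<zeta> * \<mu>)) - B2 \<epsilon>) (at_right 0)"
      using kap0 by (intro order_tendstoD(1)[where y = "1 - max 0 (1 - \<kappa>)"]) simp_all
    have ev1: "eventually (\<lambda>\<epsilon>. 0 < q \<epsilon>) (at_right 0)"
      by (rule order_tendstoD(1)[OF q_lim]) simp
    have "eventually (\<lambda>\<epsilon>. Re (\<zeta> * w) \<le> D * (1 - Re \<zeta>) / (2 * q \<epsilon>)) (at_right (0::real))"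
      using ev1 ev2 eventually_at_right_less[of 0]
    proof eventually_elim
      case (elim \<epsilon>)
      have "Re (d * (1 + of_real \<epsilon> * \<zeta> * \<mu>)) \<le>
         max (q \<epsilon> + D * (2 * \<epsilon> * (1 - Re \<zeta>)) / (4 * q \<epsilon>)) (B2 \<epsilon>)"
        unfolding q_def D_def B2_def
        by (rule rank_one_condition_step[OF A star WS S1 r1 rmu mu kap zeta elim(3)])
          (use elim(1) in \<open>auto simp: q_def\<close>)
      then have "Re (d * (1 + of_real \<epsilon> * \<zeta> * \<mu>)) \<le> q \<epsilon> + D * (2 * \<epsilon> * (1 - Re \<zeta>)) / (4 * q \<epsilon>)"
        using elim(2) by linarith
      moreover have "Re (d * (1 + of_real \<epsilon> * \<zeta> * \<mu>)) = q \<epsilon> + \<epsilon> * Re (\<zeta> * w)"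
        by (simp add: q_def w_def algebra_simps)
      ultimately have "\<epsilon> * Re (\<zeta> * w) \<le> D * (2 * \<epsilon> * (1 - Re \<zeta>)) / (4 * q \<epsilon>)" by simp
      also have "\<dots> = \<epsilon> * (D * (1 - Re \<zeta>) / (2 * q \<epsilon>))" using elim(1) by (simp add: field_simps)
      finally show ?case using elim(3) by (simp only: mult_le_cancel_left_pos)
    qed
    moreover have "((\<lambda>\<epsilon>. D * (1 - Re \<zeta>) / (2 * q \<epsilon>)) \<longlongrightarrow> D * (1 - Re \<zeta>) / (2 * 1)) (at_right 0)"
      by (intro tendsto_intros q_lim) auto
    ultimately have "Re (\<zeta> * w) \<le> D * (1 - Re \<zeta>) / (2 * 1)"
      by (intro tendsto_le[OF _ _ tendsto_const]) auto
    then show ?thesis by simp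
  qed
  \<comment> \<open>The inequalities over all phases describe the disc of radius
    \<open>D / 2\<close> about \<open>- (D / 2)\<close>; the phase aligned with
    \<open>w + D / 2\<close> yields membership of \<open>w\<close>. Dividing the squared inequality
    by \<open>D\<close> gives the claim.\<close>
  obtain \<zeta> where zeta: "cmod \<zeta> = 1" "\<zeta> * (w + of_real (D / 2)) = of_real (cmod (w + of_real (D / 2)))"
    by (rule unit_phase)
  have "cmod (w + of_real (D / 2)) = Re (\<zeta> * (w + of_real (D / 2)))"
    unfolding zeta(2) by simp
  also have "\<dots> = Re (\<zeta> * w) + D / 2 * Re \<zeta>"
    by (simp add: algebra_simps)
  also have "\<dots> \<le> D / 2" using *[OF zeta(1)] by (simp add: algebra_simps)
  finally have "(cmod (w + of_real (D / 2)))\<^sup>2 \<le> (D / 2)\<^sup>2"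
    by (intro power_mono) auto
  moreover have "(cmod (w + of_real (D / 2)))\<^sup>2 = (cmod w)\<^sup>2 + D * Re w + (D / 2)\<^sup>2"
    unfolding cmod_power2 by (simp add: power2_eq_square algebra_simps)
  moreover have "(cmod w)\<^sup>2 = D * (cmod (\<mu> - 1))\<^sup>2"
    by (simp add: w_def D_def norm_mult power_mult_distrib)
  ultimately have "D * ((cmod (\<mu> - 1))\<^sup>2 + Re w) \<le> 0" by (simp add: algebra_simps)
  then have "(cmod (\<mu> - 1))\<^sup>2 + Re w \<le> 0" using D0 by (simp add: mult_le_0_iff)
  then show ?thesis using d by (simp add: w_def algebra_simps)
qed

text \<open>
  The tilts \<open>t\<close> for which \<open>S - {1}\<close> satisfies the disc inequality form a closed set; it is also open,
  because the inequality provides the uniform gap that the preceding lemma needs as a hypothesis.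
\<close>

lemma rank_one_condition_nonneg_spectrum:
  assumes A: "bounded_op A" and star: "rank_one_condition A"
    and WS: "numerical_range A \<subseteq> convex hull S" and S1: "\<And>a. a \<in> S \<Longrightarrow> cmod a \<le> 1"
    and one: "1 \<in> S" and red: "\<And>a. a \<in> S \<Longrightarrow> reducing_approx_eigenvalue A a"
    and rho: "\<rho> > 0" "\<And>a. a \<in> S - {1} \<Longrightarrow> \<rho> \<le> cmod (a - 1)"
  shows "S \<subseteq> \<real>\<^sub>\<ge>\<^sub>0"
proof -
  define T where "T = (\<Inter>a\<in>S - {1}. {t. Re a + t * Im a \<le> 1 - (cmod (a - 1))\<^sup>2})"
  have rho2: "\<rho>\<^sup>2 \<le> (cmod (a - 1))\<^sup>2" if "a \<in> S - {1}" for a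
    using rho that by (intro power_mono) auto
  \<comment> \<open>Self-improvement: a gap of only \<open>\<rho>\<^sup>2 / 2\<close> already yields
    the disc inequality, which in turn guarantees the gap \<open>\<rho>\<^sup>2\<close>. The
    functional is multiplication by \<open>Complex 1 (- t)\<close>.\<close>
  have key: "t \<in> T" if gap: "\<And>a. a \<in> S - {1} \<Longrightarrow> Re a + t * Im a \<le> 1 - \<rho>\<^sup>2 / 2" for t
    unfolding T_def
  proof clarify
    fix a assume a: "a \<in> S" "a \<noteq> 1"
    have "Re (Complex 1 (- t) * a) \<le> 1 - (cmod (a - 1))\<^sup>2"
      by (rule rank_one_condition_disc[OF A star WS S1 red[OF one] red[OF a(1)] a(2), of _ "\<rho>\<^sup>2 / 2"])
        (use gap rho in auto)
    then show "Re a + t * Im a \<le> 1 - (cmod (a - 1))\<^sup>2" by simp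
  qed
  have "closed T"
    unfolding T_def by (intro closed_INT ballI closed_Collect_le continuous_intros)
  \<comment> \<open>Half of the guaranteed gap may be spent on moving \<open>t\<close>: since
    \<open>\<bar>Im a\<bar> \<le> 1\<close>, a move by less than \<open>\<rho>\<^sup>2 / 2\<close>
    leaves what \<open>key\<close> requires.\<close>
  moreover have "open T"
    unfolding open_dist
  proof (intro ballI exI conjI allI impI)
    fix t t' assume t: "t \<in> T" and t': "dist t' t < \<rho>\<^sup>2 / 2"
    show "t' \<in> T"
    proof (rule key)
      fix a assume a: "a \<in> S - {1}"
      have "(t' - t) * Im a \<le> \<bar>t' - t\<bar> * \<bar>Im a\<bar>" by (simp flip: abs_mult)
      also have "\<dots> \<le> \<rho>\<^sup>2 / 2 * 1"
        using t' abs_Im_le_cmod[of a] S1[of a] a by (intro mult_mono) (auto simp: dist_real_def)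
      finally have "t' * Im a \<le> t * Im a + \<rho>\<^sup>2 / 2" by (simp add: algebra_simps)
      moreover have "Re a + t * Im a \<le> 1 - (cmod (a - 1))\<^sup>2" using t a by (auto simp: T_def)
      ultimately show "Re a + t' * Im a \<le> 1 - \<rho>\<^sup>2 / 2" using rho2[OF a] by linarith
    qed
  qed (use rho in auto)
  \<comment> \<open>Starting point of the continuation: \<open>cmod a \<le> 1\<close> alone bounds
    \<open>Re a\<close> by 1 minus half of \<open>(cmod (a - 1))\<^sup>2\<close>.\<close>
  moreover have "0 \<in> T"
  proof (rule key)
    fix a assume a: "a \<in> S - {1}"
    have "(cmod (a - 1))\<^sup>2 = (cmod a)\<^sup>2 - 2 * Re a + 1"
      unfolding cmod_power2 by (simp add: power2_eq_square algebra_simps)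
    moreover have "(cmod a)\<^sup>2 \<le> 1" using S1[of a] a by (simp add: power_le_one)
    ultimately show "Re a + 0 * Im a \<le> 1 - \<rho>\<^sup>2 / 2" using rho2[OF a] by simp
  qed
  ultimately have T: "T = UNIV" using clopen[of T] by auto
  show ?thesis
  proof
    fix a assume a: "a \<in> S"
    show "a \<in> \<real>\<^sub>\<ge>\<^sub>0"
    proof (cases "a = 1")
      case False
      \<comment> \<open>Being valid for every \<open>t\<close>, the bound forces
        \<open>Im a = 0\<close>; at \<open>t = 0\<close> it then says
        \<open>(Re a)\<^sup>2 \<le> Re a\<close>.\<close>
      have le: "Re a + t * Im a \<le> 1 - (cmod (a - 1))\<^sup>2" for t
      proof -
        have "t \<in> T" by (simp add: T)
        then show ?thesis using a False by (auto simp: T_def)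
      qed
      have im: "Im a = 0"
      proof (rule ccontr)
        assume "Im a \<noteq> 0"
        then have "Re a + ((2 - Re a) / Im a) * Im a = 2" by simp
        then show False using le[of "(2 - Re a) / Im a"] zero_le_power2[of "cmod (a - 1)"] by linarith
      qed
      have "(cmod (a - 1))\<^sup>2 = (Re a - 1)\<^sup>2" unfolding cmod_power2 using im by simp
      then have "(Re a)\<^sup>2 \<le> Re a" using le[of 0] by (simp add: power2_eq_square algebra_simps)
      then have "Re a \<ge> 0" using zero_le_power2[of "Re a"] by linarith
      then show ?thesis using im by (simp add: complex_nonneg_Reals_iff)
    qed simp
  qed
qed

lemma convex_nonneg_Reals: "convex (\<real>\<^sub>\<ge>\<^sub>0 :: complex set)"
  by (auto simp: convex_def complex_nonneg_Reals_iff)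

text \<open>Common core of both cases: \<open>S\<close> is the vertex set of the polygon or the
  spectrum. Dividing by \<open>l\<close> moves the farthest point to 1, and closedness of
  \<open>S - {l}\<close> provides the positive distance \<open>\<rho>\<close>.\<close>

theorem rank_one_condition_imp_multiple_psd:
  assumes A: "bounded_op A" and star: "rank_one_condition A"
    and WS: "numerical_range A \<subseteq> convex hull S" and lS: "l \<in> S"
    and max: "\<And>a. a \<in> S \<Longrightarrow> cmod a \<le> cmod l"
    and red: "\<And>a. a \<in> S \<Longrightarrow> reducing_approx_eigenvalue A a"
    and cl: "closed (S - {l})"
  shows "\<exists>\<gamma> P. psd_op P \<and> A = (\<lambda>x. \<gamma> *\<^sub>C P x)"
proof -
  have scaled: "\<exists>\<gamma> P. psd_op P \<and> A = (\<lambda>x. \<gamma> *\<^sub>C P x)"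
    if k: "k \<noteq> 0" and W: "(*) k ` S \<subseteq> \<real>\<^sub>\<ge>\<^sub>0" for k
  proof (intro exI conjI)
    let ?P = "\<lambda>x. k *\<^sub>C A x"
    show "A = (\<lambda>x. inverse k *\<^sub>C ?P x)" using k by (simp add: scaleC_scaleC)
    have "(*) k ` (convex hull S) = convex hull ((*) k ` S)"
      by (rule convex_hull_linear_image) (rule bounded_linear.linear[OF bounded_linear_mult_right])
    also have "\<dots> \<subseteq> \<real>\<^sub>\<ge>\<^sub>0" by (intro hull_minimal W convex_nonneg_Reals)
    finally have WP: "k * w \<in> \<real>\<^sub>\<ge>\<^sub>0" if "w \<in> numerical_range A" for w using WS that by auto
    have "cinner (?P x) x \<in> \<real>\<^sub>\<ge>\<^sub>0" for x
    proof (cases "x = 0")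
      case False
      have "of_real ((norm x)\<^sup>2) * (k * (cinner (A x) x / of_real ((norm x)\<^sup>2))) \<in> \<real>\<^sub>\<ge>\<^sub>0"
        by (intro nonneg_Reals_mult_I WP numerical_range_memI'[OF A False]) simp
      then show ?thesis using False by (simp add: cinner_simps)
    qed simp
    then show "psd_op ?P" unfolding psd_op_def using bounded_op_scale[OF A] by blast
  qed
  show ?thesis
  proof (cases "l = 0")
    case True
    then have "S \<subseteq> {0}" using max by auto
    then show ?thesis by (intro scaled[of 1]) auto
  next
    case False
    define k where "k = inverse l"
    have k: "k \<noteq> 0" "k * l = 1" using False by (simp_all add: k_def)
    let ?A = "\<lambda>x. k *\<^sub>C A x" and ?S = "(*) k ` S"
    obtain \<rho> where rho: "\<rho> > 0" "\<And>a. a \<in> S - {l} \<Longrightarrow> \<rho> \<le> dist l a"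
      using separate_point_closed[OF cl, of l] by auto
    have "?S \<subseteq> \<real>\<^sub>\<ge>\<^sub>0"
    proof (rule rank_one_condition_nonneg_spectrum[of ?A _ "cmod k * \<rho>"])
      show "numerical_range ?A \<subseteq> convex hull ?S"
      proof -
        have "convex hull ?S = (*) k ` (convex hull S)"
          by (rule convex_hull_linear_image[symmetric]) (rule bounded_linear.linear[OF bounded_linear_mult_right])
        then show ?thesis using WS by (auto simp: numerical_range_def cinner_simps)
      qed
      fix a assume "a \<in> ?S"
      then obtain b where b: "b \<in> S" "a = k * b" by auto
      have "cmod k * cmod b \<le> cmod k * cmod l" by (intro mult_left_mono max b) auto
      then show "cmod a \<le> 1" using k(2) b(2) by (metis norm_mult norm_one)
      show "reducing_approx_eigenvalue ?A a"
        unfolding reducing_approx_eigenvalue_def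
      proof (intro allI impI)
        fix \<epsilon> :: real assume "\<epsilon> > 0"
        then have "\<epsilon> / cmod k > 0" using k by simp
        then obtain e where e: "norm e = 1" "\<And>z. cmod (cinner (A e) z - b * cinner e z) \<le> \<epsilon> / cmod k * norm z"
           "\<And>z. cmod (cinner (A z) e - b * cinner z e) \<le> \<epsilon> / cmod k * norm z"
          using red[OF b(1)] unfolding reducing_approx_eigenvalue_def by blast
        have "cmod (k * X - k * b * Y) \<le> \<epsilon> * n" if "cmod (X - b * Y) \<le> \<epsilon> / cmod k * n" for X Y n
        proof -
          have "cmod (k * X - k * b * Y) = cmod k * cmod (X - b * Y)"
            by (simp add: norm_mult[symmetric] algebra_simps)
          also have "\<dots> \<le> cmod k * (\<epsilon> / cmod k * n)" by (intro mult_left_mono that) auto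
          finally show ?thesis using k by simp
        qed
        then show "\<exists>e. norm e = 1 \<and> (\<forall>z. cmod (cinner (?A e) z - a * cinner e z) \<le> \<epsilon> * norm z \<and>
            cmod (cinner (?A z) e - a * cinner z e) \<le> \<epsilon> * norm z)"
          using e unfolding b(2) by (intro exI[of _ e]) (auto simp: cinner_simps)
      qed
    next
      fix a assume "a \<in> ?S - {1}"
      then obtain b where b: "b \<in> S - {l}" "a = k * b" using k by auto
      have "a - 1 = k * (b - l)" using k b by (simp add: algebra_simps)
      then show "cmod k * \<rho> \<le> cmod (a - 1)"
        using rho(2)[OF b(1)] by (simp add: norm_mult dist_norm norm_minus_commute mult_left_mono)
    next
      show "1 \<in> ?S" using lS k(2) by (metis imageI)
    qed (use k rho bounded_op_scale[OF A] rank_one_condition_scale[OF star] in auto)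
    then show ?thesis by (rule scaled[OF k(1)])
  qed
qed

section \<open>Multiples of positive semidefinite operators\<close>

text \<open>Polarisation: reality of the form at \<open>x + y\<close>, and again with
  \<open>\<i> *\<^sub>C y\<close> for \<open>y\<close>, compares imaginary and real parts of the two
  mixed terms.\<close>

lemma cinner_hermitian_of_real_form:
  assumes P: "bounded_op P" and re: "\<And>x. Im (cinner (P x) x) = 0"
  shows "cinner (P x) y = cinner x (P y)"
proof -
  have 1: "Im (cinner (P x) y + cinner (P y) x) = 0" for y
    using re[of "x + y"] re[of x] re[of y] by (simp add: bounded_op_simps[OF P] cinner_simps)
  have "Re (cinner (P x) y) = Re (cinner (P y) x)" "Im (cinner (P x) y) = - Im (cinner (P y) x)"
    using 1[of y] 1[of "\<i> *\<^sub>C y"] by (simp_all add: bounded_op_simps[OF P] cinner_simps)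
  then have "cinner (P x) y = cnj (cinner (P y) x)" by (simp add: complex_eq_iff)
  then show ?thesis by (metis cinner_commute)
qed

lemma psd_op_inner:
  assumes "psd_op P"
  shows "cinner (P x) x = of_real (inner (P x) x)" "inner (P x) x \<ge> 0" "inner (P x) y = inner x (P y)"
proof -
  have P: "bounded_op P" and nn: "\<And>x. cinner (P x) x \<in> \<real>\<^sub>\<ge>\<^sub>0"
    using assms by (auto simp: psd_op_def)
  show "cinner (P x) x = of_real (inner (P x) x)" "inner (P x) x \<ge> 0"
    using nn[of x] by (auto simp: complex_nonneg_Reals_iff inner_eq_Re_cinner complex_eq_iff)
  show "inner (P x) y = inner x (P y)"
    unfolding inner_eq_Re_cinner
    by (subst cinner_hermitian_of_real_form[OF P]) (use nn in \<open>auto simp: complex_nonneg_Reals_iff\<close>)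
qed

lemma psd_op_inner_pos:
  assumes P: "psd_op P" and y: "P y \<noteq> 0"
  shows "inner (P y) y > 0"
proof -
  have b: "bounded_op P" using P by (simp add: psd_op_def)
  obtain K where K: "K > 0" "\<And>x. norm (P x) \<le> K * norm x"
    using bounded_op_bound[OF b] by blast
  have "(norm (P y))\<^sup>2 \<le> K * inner (P y) y"
    by (rule symmetric_psd_norm_le[OF bounded_op_imp_bounded_linear[OF b] psd_op_inner(3,2)[OF P] K(2)])
  moreover have "(norm (P y))\<^sup>2 > 0" using y by simp
  ultimately have "K * inner (P y) y > 0" by linarith
  then show ?thesis using K(1) by (simp add: zero_less_mult_iff)
qed

text \<open>
  For \<open>P = R\<^sup>2\<close> with \<open>R\<close> positive this is the value of the form of \<open>P\<close> at the normalised \<open>R y\<close>. No square root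
  is needed, since the quotient lies between the values of the form at \<open>y\<close> and at \<open>P y\<close>.
\<close>

lemma psd_op_quotient_in_numerical_range:
  assumes P: "psd_op P" and y: "P y \<noteq> 0"
  shows "complex_of_real ((norm (P y))\<^sup>2 / inner (P y) y) \<in> numerical_range P"
proof -
  have b: "bounded_op P" using P by (simp add: psd_op_def)
  define s where "s = inner (P y) y"
  define u where "u = inner (P (P y)) (P y)"
  have y0: "y \<noteq> 0" using y b by auto
  have s0: "s > 0" using psd_op_inner_pos[OF P y] by (simp add: s_def)
  have "complex_of_real (s / (norm y)\<^sup>2) \<in> numerical_range P"
    using numerical_range_memI'[OF b y0] by (simp add: psd_op_inner(1)[OF P] s_def)
  moreover have "complex_of_real (u / (norm (P y))\<^sup>2) \<in> numerical_range P"
    using numerical_range_memI'[OF b y] by (simp add: psd_op_inner(1)[OF P] u_def)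
  \<comment> \<open>Cauchy-Schwarz for the inner product gives this lower comparison; Cauchy-Schwarz
    for the form of \<open>P\<close>, at \<open>y\<close> and \<open>P y\<close>, gives the upper
    one.\<close>
  moreover have "s / (norm y)\<^sup>2 \<le> (norm (P y))\<^sup>2 / s"
  proof -
    have "s * s \<le> (norm (P y) * norm y) * (norm (P y) * norm y)"
      using norm_cauchy_schwarz[of "P y" y] s0 by (intro mult_mono) (auto simp: s_def)
    then show ?thesis using s0 y0 by (simp add: field_simps power2_eq_square)
  qed
  moreover have "(norm (P y))\<^sup>2 / s \<le> u / (norm (P y))\<^sup>2"
  proof -
    have "((norm (P y))\<^sup>2)\<^sup>2 \<le> s * u"
      using symmetric_psd_cauchy_schwarz[OF bounded_op_imp_bounded_linear[OF b] psd_op_inner(3,2)[OF P],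
          of y "P y"]
      by (simp add: power2_norm_eq_inner s_def u_def)
    then show ?thesis using s0 y by (simp add: field_simps power2_eq_square)
  qed
  ultimately have "(norm (P y))\<^sup>2 / s \<in> closed_segment (s / (norm y)\<^sup>2) (u / (norm (P y))\<^sup>2)"
    by (auto simp only: closed_segment_eq_real_ivl atLeastAtMost_iff split: if_splits)
  then have "complex_of_real ((norm (P y))\<^sup>2 / s) \<in>
      closed_segment (complex_of_real (s / (norm y)\<^sup>2)) (complex_of_real (u / (norm (P y))\<^sup>2))"
    unfolding closed_segment_of_real by (rule imageI)
  also have "\<dots> \<subseteq> numerical_range P"
    using \<open>complex_of_real (s / (norm y)\<^sup>2) \<in> _\<close> \<open>complex_of_real (u / (norm (P y))\<^sup>2) \<in> _\<close>
      toeplitz_hausdorff[OF b] by (simp add: closed_segment_subset)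
  finally show ?thesis by (simp add: s_def)
qed

text \<open>Besides approximate eigenvectors for nonzero \<open>l\<close> there are two cases. A
  vector \<open>w\<close> orthogonal to the range of PB - l gives \<open>l\<close> exactly as a
  product, with \<open>P w\<close> used in W(B). If \<open>l = 0\<close> with approximate
  eigenvectors, \<open>P\<close> or \<open>B\<close> fails to be bounded below, so one factor has
  values near 0.\<close>

theorem spectrum_psd_comp_subset:
  assumes P: "psd_op P" and B: "bounded_op B"
  shows "spectrum (P \<circ> B) \<subseteq> closure (numerical_range P * numerical_range B)"
proof
  fix l assume l: "l \<in> spectrum (P \<circ> B)"
  have bP: "bounded_op P" using P by (simp add: psd_op_def)
  let ?T = "\<lambda>x. (P \<circ> B) x - l *\<^sub>C x"
  have T: "bounded_op ?T" by (intro bounded_op_shift bounded_op_comp bP B)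
  obtain KP where KP: "KP > 0" "\<And>x. norm (P x) \<le> KP * norm x"
    using bounded_op_bound[OF bP] by blast
  obtain KB where KB: "KB > 0" "\<And>x. norm (B x) \<le> KB * norm x"
    using bounded_op_bound[OF B] by blast
  have cP: "cinner (P x) y = cinner x (P y)" for x y
    using cinner_hermitian_of_real_form[OF bP] psd_op_inner(1)[OF P] by simp
  have "\<not> invertible_op ?T" using l by (simp add: spectrum_def)
  from not_invertible_op_cases[OF T this]
  show "l \<in> closure (numerical_range P * numerical_range B)"
  proof (elim disjE exE conjE)
    fix w assume w: "norm w = 1" "\<forall>x. cinner (?T x) w = 0"
    have orth: "cinner (B x) (P w) = l * cinner x w" for x
      using w(2) by (simp add: cinner_simps cP)
    have "l \<in> numerical_range P * numerical_range B"
    proof (cases "P w = 0")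
      case True
      then have "l = 0" using orth[of w] w(1) by (simp add: cinner_self)
      moreover have "0 \<in> numerical_range P" using numerical_range_memI[OF w(1), of P] True by simp
      ultimately show ?thesis
        using set_times_intro[OF _ numerical_range_memI[OF w(1), of B], of 0] by simp
    next
      case False
      define s where "s = inner (P w) w"
      have s0: "s > 0" using psd_op_inner_pos[OF P False] by (simp add: s_def)
      have "cinner (B (P w)) (P w) / of_real ((norm (P w))\<^sup>2) \<in> numerical_range B"
        by (rule numerical_range_memI'[OF B False])
      from set_times_intro[OF psd_op_quotient_in_numerical_range[OF P False] this]
      have "complex_of_real ((norm (P w))\<^sup>2 / s) * (l * of_real s / of_real ((norm (P w))\<^sup>2))
          \<in> numerical_range P * numerical_range B"
        by (simp only: orth psd_op_inner(1)[OF P] s_def)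
      moreover have "complex_of_real ((norm (P w))\<^sup>2 / s) * (l * of_real s / of_real ((norm (P w))\<^sup>2)) = l"
        using s0 False by (simp add: field_simps)
      ultimately show ?thesis by simp
    qed
    then show ?thesis using closure_subset by blast
  next
    assume small: "\<forall>\<epsilon>>0. \<exists>x. norm x = 1 \<and> norm (?T x) < \<epsilon>"
    show ?thesis
    proof (cases "l = 0")
      case True
      then have small0: "\<exists>x. norm x = 1 \<and> norm (P (B x)) < \<epsilon>" if "\<epsilon> > 0" for \<epsilon>
        using small that by auto
      show ?thesis
        unfolding closure_approachable
      proof (intro allI impI)
        fix \<epsilon> :: real assume eps: "\<epsilon> > 0"
        show "\<exists>y\<in>numerical_range P * numerical_range B. dist y l < \<epsilon>"
        \<comment> \<open>Either \<open>P\<close> nearly kills a unit vector, or \<open>P\<close> is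
          bounded below by \<open>\<epsilon> / KB\<close> and smallness of \<open>P (B x)\<close>
          passes to \<open>B x\<close>. In both cases the product of the two form values at that
          same vector is below \<open>\<epsilon>\<close>.\<close>
        proof (cases "\<exists>x. norm x = 1 \<and> norm (P x) < \<epsilon> / KB")
          case True
          then obtain x where x: "norm x = 1" "norm (P x) < \<epsilon> / KB" by blast
          have "cmod (cinner (P x) x * cinner (B x) x) \<le> norm (P x) * KB"
            unfolding norm_mult
            using numerical_range_bounded[OF KB(2) numerical_range_memI[OF x(1)]]
              norm_cinner_le[of "P x" x] x(1) by (intro mult_mono) auto
          also have "\<dots> < \<epsilon>" using x(2) KB(1) by (simp add: field_simps)
          finally show ?thesis
            using \<open>l = 0\<close> x(1)
            by (intro bexI[of _ "cinner (P x) x * cinner (B x) x"] set_times_intro numerical_range_memI)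
              (auto simp: dist_norm)
        next
          case False
          define c where "c = \<epsilon> / KB"
          have c0: "c > 0" using eps KB by (simp add: c_def)
          have unit_low: "c \<le> norm (P x)" if "norm x = 1" for x
            using False that unfolding c_def by (meson not_le)
          have low: "c * norm y \<le> norm (P y)" for y
          proof (cases "y = 0")
            case y: False
            have "norm ((1 / norm y) *\<^sub>R y) = 1" using y by simp
            from unit_low[OF this] show ?thesis using y by (simp add: bounded_op_simps[OF bP] field_simps)
          qed (use bP in simp)
          obtain x where x: "norm x = 1" "norm (P (B x)) < c * (\<epsilon> / KP)"
            using small0[of "c * (\<epsilon> / KP)"] c0 eps KP by auto
          have "c * norm (B x) < c * (\<epsilon> / KP)" using low[of "B x"] x(2) by linarith
          then have Bx: "norm (B x) < \<epsilon> / KP"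
            using c0 by (simp only: mult_less_cancel_left_pos)
          have "cmod (cinner (P x) x * cinner (B x) x) \<le> KP * norm (B x)"
            unfolding norm_mult
            using numerical_range_bounded[OF KP(2) numerical_range_memI[OF x(1)]]
              norm_cinner_le[of "B x" x] x(1) KP(1) by (intro mult_mono) auto
          also have "\<dots> < \<epsilon>" using Bx KP(1) by (simp add: field_simps)
          finally show ?thesis
            using \<open>l = 0\<close> x(1)
            by (intro bexI[of _ "cinner (P x) x * cinner (B x) x"] set_times_intro numerical_range_memI)
              (auto simp: dist_norm)
        qed
      qed
    next
      case False
      then have l0: "cmod l > 0" by simp
      show ?thesis
        unfolding closure_approachable
      proof (intro allI impI)
        fix \<epsilon> :: real assume eps: "\<epsilon> > 0"
        \<comment> \<open>Total error per unit of \<open>\<eta>\<close>: replacing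
          \<open>norm (P y)\<close> by \<open>cmod l\<close> in squares costs
          \<open>2 * cmod l + 1\<close>, and the remainder \<open>rr\<close> costs
          \<open>KB * KP\<close>.\<close>
        define C where "C = 2 * cmod l + 1 + KB * KP"
        have C0: "C > 0" using l0 KB KP by (simp add: C_def add_pos_pos)
        define \<eta> where "\<eta> = min 1 (min (cmod l / 2) (\<epsilon> * cmod l / (2 * C)))"
        have eta_pos: "\<eta> > 0" using l0 eps C0 by (simp add: \<eta>_def)
        have "\<eta> \<le> 1" "\<eta> \<le> cmod l / 2" by (simp_all add: \<eta>_def)
        with eta_pos l0 have eta: "\<eta> > 0" "\<eta> \<le> 1" "\<eta> < cmod l" by linarith+
        have "\<eta> \<le> \<epsilon> * cmod l / (2 * C)" by (simp add: \<eta>_def)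
        then have "\<eta> * C \<le> \<epsilon> * cmod l / 2" using C0 by (simp add: field_simps)
        also have "\<dots> < \<epsilon> * cmod l" using eps l0 by simp
        finally have etaC: "\<eta> * C < \<epsilon> * cmod l" .
        obtain x where x: "norm x = 1" "norm (P (B x) - l *\<^sub>C x) < \<eta>"
          using small eta(1) by auto
        define y where "y = B x"
        define rr where "rr = P y - l *\<^sub>C x"
        have Py: "P y = l *\<^sub>C x + rr" and rr: "norm rr < \<eta>"
          using x by (simp_all add: rr_def y_def)
        have nlx: "norm (l *\<^sub>C x) = cmod l" using x(1) by (simp add: norm_scaleC)
        have dev: "\<bar>norm (P y) - cmod l\<bar> \<le> \<eta>"
          using norm_triangle_ineq3[of "P y" "l *\<^sub>C x"] rr by (simp add: rr_def nlx)
        have Py0: "P y \<noteq> 0" using dev eta(3) by auto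
        define s where "s = inner (P y) y"
        have s0: "s > 0" using psd_op_inner_pos[OF P Py0] by (simp add: s_def)
        define t where "t = (norm (P y))\<^sup>2 / s"
        have tW: "complex_of_real t \<in> numerical_range P"
          using psd_op_quotient_in_numerical_range[OF P Py0] by (simp add: t_def s_def)
        have t0: "t \<ge> 0" using s0 by (simp add: t_def)
        then have tK: "t \<ge> 0" "t \<le> KP"
          using numerical_range_bounded[OF KP(2) tW] by simp_all
        define b where "b = cinner y x"
        have bW: "b \<in> numerical_range B" using numerical_range_memI[OF x(1), of B] by (simp add: b_def y_def)
        have "of_real s = cinner y (P y)"
          using psd_op_inner(1)[OF P, of y] by (simp add: s_def cP)
        also have "\<dots> = cnj l * b + cinner y rr"
          unfolding Py by (simp add: cinner_simps b_def)
        finally have lb: "cnj l * b = of_real s - cinner y rr" by simp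
        \<comment> \<open>Since \<open>t * s\<close> is the square of \<open>norm (P y)\<close>,
          multiplying by \<open>cnj l\<close> reduces the claim to comparing that square with the
          square of \<open>cmod l\<close>.\<close>
        have "cnj l * (of_real t * b - l) = of_real t * (cnj l * b) - cnj l * l"
          by (simp add: algebra_simps)
        also have "\<dots> = of_real ((norm (P y))\<^sup>2 - (cmod l)\<^sup>2) - of_real t * cinner y rr"
        proof -
          have "complex_of_real t * of_real s = of_real ((norm (P y))\<^sup>2)"
            using s0 by (simp add: t_def flip: of_real_mult)
          moreover have "cnj l * l = of_real ((cmod l)\<^sup>2)"
            by (metis complex_norm_square mult.commute of_real_power)
          ultimately show ?thesis unfolding lb right_diff_distrib by simp
        qed
        finally have "cmod l * cmod (of_real t * b - l)
            = cmod (of_real ((norm (P y))\<^sup>2 - (cmod l)\<^sup>2) - of_real t * cinner y rr)"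
          by (metis complex_mod_cnj norm_mult)
        also have "\<dots> \<le> \<bar>(norm (P y))\<^sup>2 - (cmod l)\<^sup>2\<bar> + t * cmod (cinner y rr)"
          by (rule order_trans[OF norm_triangle_ineq4])
            (simp only: norm_of_real norm_mult abs_of_nonneg[OF tK(1)])
        also have "\<dots> \<le> \<eta> * (2 * cmod l + 1) + KP * (KB * \<eta>)"
        proof (intro add_mono mult_mono)
          have "(norm (P y))\<^sup>2 - (cmod l)\<^sup>2 = (norm (P y) - cmod l) * (norm (P y) + cmod l)"
            by (simp add: power2_eq_square algebra_simps)
          then have "\<bar>(norm (P y))\<^sup>2 - (cmod l)\<^sup>2\<bar> = \<bar>norm (P y) - cmod l\<bar> * (norm (P y) + cmod l)"
            by (simp add: abs_mult)
          also have "\<dots> \<le> \<eta> * (2 * cmod l + 1)"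
            using dev eta by (intro mult_mono) auto
          finally show "\<bar>(norm (P y))\<^sup>2 - (cmod l)\<^sup>2\<bar> \<le> \<eta> * (2 * cmod l + 1)" .
          have "cmod (cinner y rr) \<le> norm y * norm rr" by (rule norm_cinner_le)
          also have "\<dots> \<le> KB * \<eta>"
            using KB(2)[of x] x(1) rr KB(1) by (intro mult_mono) (auto simp: y_def)
          finally show "cmod (cinner y rr) \<le> KB * \<eta>" .
        qed (use tK KP in auto)
        also have "\<dots> = \<eta> * C" by (simp add: C_def algebra_simps)
        finally have "cmod l * cmod (of_real t * b - l) < cmod l * \<epsilon>" using etaC by (simp add: mult.commute)
        then have "cmod (of_real t * b - l) < \<epsilon>" using l0 by simp
        then show "\<exists>y\<in>numerical_range P * numerical_range B. dist y l < \<epsilon>"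
          using tW bW by (intro bexI[of _ "of_real t * b"] set_times_intro) (auto simp: dist_norm)
      qed
    qed
  qed
qed

text \<open>The scalar moves from \<open>P\<close> to \<open>B\<close>, in the composition as well
  as in the product of numerical ranges.\<close>

lemma spectrum_multiple_psd_comp_subset:
  assumes P: "psd_op P" and B: "bounded_op B"
  shows "spectrum ((\<lambda>x. \<gamma> *\<^sub>C P x) \<circ> B)
    \<subseteq> closure (numerical_range (\<lambda>x. \<gamma> *\<^sub>C P x) * numerical_range B)"
proof -
  have bP: "bounded_op P" using P by (simp add: psd_op_def)
  let ?B = "\<lambda>x. \<gamma> *\<^sub>C B x"
  have eq: "(\<lambda>x. \<gamma> *\<^sub>C P x) \<circ> B = P \<circ> ?B"
    by (simp add: fun_eq_iff bounded_op_simps[OF bP])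
  have "numerical_range P * numerical_range ?B \<subseteq> numerical_range (\<lambda>x. \<gamma> *\<^sub>C P x) * numerical_range B"
  proof
    fix z assume "z \<in> numerical_range P * numerical_range ?B"
    then obtain u v where u: "norm u = 1" and v: "norm v = 1"
      and z: "z = cinner (P u) u * cinner (\<gamma> *\<^sub>C B v) v"
      by (auto simp: set_times_def numerical_range_def)
    have "z = cinner (\<gamma> *\<^sub>C P u) u * cinner (B v) v"
      unfolding z cinner_simps by (simp only: mult_ac)
    then show "z \<in> numerical_range (\<lambda>x. \<gamma> *\<^sub>C P x) * numerical_range B"
      using u v by (auto intro!: set_times_intro simp: numerical_range_def)
  qed
  from order_trans[OF spectrum_psd_comp_subset[OF P bounded_op_scale[OF B]] closure_mono[OF this]]
  show ?thesis unfolding eq .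
qed

section \<open>Normal operators\<close>

lemma normal_op_commute:
  assumes "normal_op A"
  shows "cadjoint A (A x) = A (cadjoint A x)"
  using assms unfolding normal_op_def by (metis comp_apply)

text \<open>A - z is again normal, so it and its adjoint have equal norms at every vector. Thus
  every approximate eigenvector is reducing.\<close>

lemma normal_op_norm_shift:
  assumes A: "normal_op A"
  shows "norm (cadjoint A x - cnj z *\<^sub>C x) = norm (A x - z *\<^sub>C x)"
proof -
  have b: "bounded_op A" using A by (simp add: normal_op_def)
  have 1: "cinner (cadjoint A x) (cadjoint A x) = cinner (A x) (A x)"
    by (metis b cadjoint cadjoint' normal_op_commute[OF A])
  have 2: "cinner (cadjoint A x) x = cinner x (A x)" "cinner x (cadjoint A x) = cinner (A x) x"
    by (simp_all add: cadjoint[OF b] cadjoint'[OF b])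
  have "cinner (cadjoint A x - cnj z *\<^sub>C x) (cadjoint A x - cnj z *\<^sub>C x)
      = cinner (A x - z *\<^sub>C x) (A x - z *\<^sub>C x)"
    by (simp add: cinner_simps 1 2 algebra_simps)
  then have "(norm (cadjoint A x - cnj z *\<^sub>C x))\<^sup>2 = (norm (A x - z *\<^sub>C x))\<^sup>2"
    unfolding cinner_self by (simp only: of_real_eq_iff)
  then show ?thesis by (simp add: power2_eq_iff_nonneg)
qed

text \<open>A vector orthogonal to the range of A - z is killed by the adjoint of A - z, hence by A
  - z itself, so the second alternative of \<open>not_invertible_op_cases\<close> is absorbed by the
  first.\<close>

lemma normal_op_spectrum_iff:
  assumes A: "normal_op A"
  shows "z \<in> spectrum A \<longleftrightarrow> (\<forall>\<epsilon>>0. \<exists>x. norm x = 1 \<and> norm (A x - z *\<^sub>C x) \<le> \<epsilon>)"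
proof
  have b: "bounded_op A" using A by (simp add: normal_op_def)
  assume "z \<in> spectrum A"
  then have "\<not> invertible_op (\<lambda>x. A x - z *\<^sub>C x)" by (simp add: spectrum_def)
  from not_invertible_op_cases[OF bounded_op_shift[OF b] this]
  show "\<forall>\<epsilon>>0. \<exists>x. norm x = 1 \<and> norm (A x - z *\<^sub>C x) \<le> \<epsilon>"
  proof (elim disjE exE conjE)
    fix w assume w: "norm w = 1" "\<forall>x. cinner (A x - z *\<^sub>C x) w = 0"
    have "cinner x (cadjoint A w - cnj z *\<^sub>C w) = cinner x 0" for x
      using w(2) by (simp add: cinner_simps cadjoint[OF b])
    then have "cadjoint A w - cnj z *\<^sub>C w = 0" by (rule cinner_eqI)
    then have "norm (A w - z *\<^sub>C w) = 0" using normal_op_norm_shift[OF A, of w z] by simp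
    then show ?thesis using w(1) by (intro allI impI exI[of _ w]) simp
  next
    assume *: "\<forall>\<epsilon>>0. \<exists>x. norm x = 1 \<and> norm (A x - z *\<^sub>C x) < \<epsilon>"
    show ?thesis
    proof (intro allI impI)
      fix \<epsilon> :: real assume "\<epsilon> > 0"
      with * obtain x where "norm x = 1" "norm (A x - z *\<^sub>C x) < \<epsilon>" by blast
      then show "\<exists>x. norm x = 1 \<and> norm (A x - z *\<^sub>C x) \<le> \<epsilon>"
        by (intro exI[of _ x]) simp
    qed
  qed
next
  assume "\<forall>\<epsilon>>0. \<exists>x. norm x = 1 \<and> norm (A x - z *\<^sub>C x) \<le> \<epsilon>"
  then show "z \<in> spectrum A"
    unfolding spectrum_def mem_Collect_eq by (intro not_bounded_below_imp_not_invertible) simp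
qed

lemma normal_op_reducing_approx_eigenvalue:
  assumes A: "normal_op A" and z: "z \<in> spectrum A"
  shows "reducing_approx_eigenvalue A z"
  unfolding reducing_approx_eigenvalue_def
proof (intro allI impI)
  fix \<epsilon> :: real assume "\<epsilon> > 0"
  then obtain e where e: "norm e = 1" "norm (A e - z *\<^sub>C e) \<le> \<epsilon>"
    using z unfolding normal_op_spectrum_iff[OF A] by blast
  have b: "bounded_op A" using A by (simp add: normal_op_def)
  show "\<exists>e. norm e = 1 \<and>
       (\<forall>y. cmod (cinner (A e) y - z * cinner e y) \<le> \<epsilon> * norm y \<and>
            cmod (cinner (A y) e - z * cinner y e) \<le> \<epsilon> * norm y)"
  proof (intro exI[of _ e] conjI allI e(1))
    fix y
    have "cmod (cinner (A e - z *\<^sub>C e) y) \<le> \<epsilon> * norm y"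
      by (rule order_trans[OF norm_cinner_le mult_right_mono[OF e(2)]]) simp
    then show "cmod (cinner (A e) y - z * cinner e y) \<le> \<epsilon> * norm y"
      by (simp add: cinner_simps)
    have "norm (cadjoint A e - cnj z *\<^sub>C e) \<le> \<epsilon>"
      using e(2) by (simp add: normal_op_norm_shift[OF A])
    then have "cmod (cinner y (cadjoint A e - cnj z *\<^sub>C e)) \<le> norm y * \<epsilon>"
      by (intro order_trans[OF norm_cinner_le mult_left_mono]) simp_all
    then show "cmod (cinner (A y) e - z * cinner y e) \<le> \<epsilon> * norm y"
      by (simp add: cinner_simps cadjoint[OF b] mult.commute)
  qed
qed

lemma normal_op_spectrum_subset_closure:
  assumes A: "normal_op A"
  shows "spectrum A \<subseteq> closure (numerical_range A)"
proof
  fix z assume z: "z \<in> spectrum A"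
  show "z \<in> closure (numerical_range A)"
    unfolding closure_approachable
  proof (intro allI impI)
    fix \<epsilon> :: real assume eps: "\<epsilon> > 0"
    then have "\<epsilon> / 2 > 0" by simp
    then obtain e where e: "norm e = 1" "norm (A e - z *\<^sub>C e) \<le> \<epsilon> / 2"
      using z unfolding normal_op_spectrum_iff[OF A] by blast
    have "cinner (A e) e - z = cinner (A e - z *\<^sub>C e) e"
      using e(1) by (simp add: cinner_simps cinner_self)
    then have "cmod (cinner (A e) e - z) \<le> norm (A e - z *\<^sub>C e) * norm e"
      by (simp only: norm_cinner_le)
    then show "\<exists>y\<in>numerical_range A. dist y z < \<epsilon>"
      using e eps by (intro bexI[OF _ numerical_range_memI[OF e(1)]]) (simp add: dist_norm)
  qed
qed

lemma bounded_numerical_range: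
  assumes "bounded_op A"
  shows "bounded (numerical_range A)"
  by (metis assms bounded_iff bounded_op_bound numerical_range_bounded)

lemma normal_op_compact_spectrum:
  assumes A: "normal_op A"
  shows "compact (spectrum A)"
proof -
  have b: "bounded_op A" using A by (simp add: normal_op_def)
  have "bounded (spectrum A)"
    using normal_op_spectrum_subset_closure[OF A] bounded_numerical_range[OF b]
    by (meson bounded_closure bounded_subset)
  moreover have "closure (spectrum A) \<subseteq> spectrum A"
  proof (rule subsetI, subst normal_op_spectrum_iff[OF A], intro allI impI)
    fix z and \<epsilon> :: real
    assume "z \<in> closure (spectrum A)" and eps: "\<epsilon> > 0"
    then have cl: "\<forall>e>0. \<exists>y\<in>spectrum A. dist y z < e" by (simp only: closure_approachable)
    from eps have "\<epsilon> / 2 > 0" by simp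
    then obtain y where y: "y \<in> spectrum A" "dist y z < \<epsilon> / 2" using cl by blast
    obtain x where x: "norm x = 1" "norm (A x - y *\<^sub>C x) \<le> \<epsilon> / 2"
      using y(1) \<open>\<epsilon> / 2 > 0\<close> unfolding normal_op_spectrum_iff[OF A] by blast
    have "norm (A x - z *\<^sub>C x) \<le> norm (A x - y *\<^sub>C x) + norm ((y - z) *\<^sub>C x)"
      by (rule order_trans[OF _ norm_triangle_ineq]) (simp add: scaleC_diff_left)
    also have "\<dots> \<le> \<epsilon>" using x y(2) by (simp add: norm_scaleC dist_norm)
    finally show "\<exists>x. norm x = 1 \<and> norm (A x - z *\<^sub>C x) \<le> \<epsilon>" using x(1) by blast
  qed
  ultimately show ?thesis by (simp add: compact_eq_bounded_closed closure_subset_eq)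
qed

text \<open>Takes the place of the spectral theorem: a joint approximate eigenvector of the
  commuting real and imaginary parts of d A, at the top \<open>m\<close> of the real part, gives a
  spectral point attaining the support value.\<close>

lemma normal_op_spectrum_support:
  assumes A: "normal_op A" and ne: "numerical_range A \<noteq> {}" and d: "d \<noteq> 0"
  obtains s where "s \<in> spectrum A" "\<And>w. w \<in> numerical_range A \<Longrightarrow> Re (d * w) \<le> Re (d * s)"
proof -
  have b: "bounded_op A" using A by (simp add: normal_op_def)
  let ?A' = "cadjoint A"
  have b': "bounded_op ?A'" by (rule bounded_op_cadjoint[OF b])
  define V where "V = (\<lambda>w. Re (d * w)) ` numerical_range A"
  define m where "m = Sup V"
  obtain K0 where K0: "\<And>w. w \<in> numerical_range A \<Longrightarrow> cmod w \<le> K0"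
    using bounded_numerical_range[OF b] by (auto simp: bounded_iff)
  have "Re (d * w) \<le> cmod d * K0" if "w \<in> numerical_range A" for w
  proof -
    have "Re (d * w) \<le> cmod d * cmod w" by (metis complex_Re_le_cmod norm_mult)
    also have "\<dots> \<le> cmod d * K0" by (intro mult_left_mono K0 that) auto
    finally show ?thesis .
  qed
  then have bdd: "bdd_above V" by (auto simp: V_def bdd_above_def)
  have Vm: "Re (d * w) \<le> m" if "w \<in> numerical_range A" for w
    unfolding m_def by (rule cSup_upper[OF _ bdd]) (use that in \<open>unfold V_def, rule imageI\<close>)
  \<comment> \<open>Cartesian decomposition of d A into self-adjoint \<open>H\<close> and
    \<open>K\<close>. Normality makes them commute, and \<open>Q = m - H\<close> is positive with
    infimum 0 on unit vectors.\<close>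
  define H where "H = (\<lambda>x. (d / 2) *\<^sub>C A x + (cnj d / 2) *\<^sub>C ?A' x)"
  define K where "K = (\<lambda>x. (d / (2 * \<i>)) *\<^sub>C A x + (- cnj d / (2 * \<i>)) *\<^sub>C ?A' x)"
  define Q where "Q = (\<lambda>x. m *\<^sub>R x - H x)"
  have bH: "bounded_op H" and bK: "bounded_op K"
    unfolding H_def K_def by (intro bounded_op_plus bounded_op_scale b b')+
  have symH: "cinner (H x) y = cinner x (H y)" and symK: "cinner (K x) y = cinner x (K y)" for x y
    by (simp_all add: H_def K_def cinner_simps cadjoint[OF b] cadjoint'[OF b])
  have comm: "H (K x) = K (H x)" for x
    by (simp add: H_def K_def bounded_op_simps[OF b] bounded_op_simps[OF b'] scaleC_right_distrib
        scaleC_scaleC normal_op_commute[OF A] algebra_simps)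
  have dA: "d *\<^sub>C A x = H x + \<i> *\<^sub>C K x" for x
  proof -
    have "H x + \<i> *\<^sub>C K x = (d / 2 + \<i> * (d / (2 * \<i>))) *\<^sub>C A x + (cnj d / 2 + \<i> * (- cnj d / (2 * \<i>))) *\<^sub>C ?A' x"
      by (simp only: H_def K_def scaleC_right_distrib scaleC_left_distrib scaleC_scaleC) (simp add: algebra_simps)
    also have "d / 2 + \<i> * (d / (2 * \<i>)) = d" by simp
    also have "cnj d / 2 + \<i> * (- cnj d / (2 * \<i>)) = 0" by simp
    finally show ?thesis by simp
  qed
  have HA: "inner (H x) x = Re (d * cinner (A x) x)" for x
  proof -
    have "cinner (?A' x) x = cnj (cinner (A x) x)" by (metis b cadjoint' cinner_commute)
    then show ?thesis by (simp add: H_def inner_eq_Re_cinner cinner_simps algebra_simps)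
  qed
  have "\<exists>k. \<forall>\<epsilon>>0. \<exists>y. norm y = 1 \<and> norm (Q y) \<le> \<epsilon> \<and> norm (K y - k *\<^sub>R y) \<le> \<epsilon>"
  proof (rule commuting_joint_approx_eigenvector)
    show "bounded_linear Q" unfolding Q_def
      by (intro bounded_linear_sub bounded_linear_scaleR_right bounded_op_imp_bounded_linear bH)
    show "bounded_linear K" by (rule bounded_op_imp_bounded_linear[OF bK])
    show "inner (K x) y = inner x (K y)" for x y by (simp add: inner_eq_Re_cinner symK)
    have "inner (H x) y = inner x (H y)" for x y by (simp add: inner_eq_Re_cinner symH)
    then show "inner (Q x) y = inner x (Q y)" for x y by (simp add: Q_def inner_simps)
    show "Q (K x) = K (Q x)" for x by (simp add: Q_def bounded_op_simps[OF bK] comm)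
    show "inner (Q x) x \<ge> 0" for x
    proof (cases "x = 0")
      case False
      have "Re (d * (cinner (A x) x / of_real ((norm x)\<^sup>2))) \<le> m"
        by (intro Vm numerical_range_memI'[OF b False])
      then have "Re (d * cinner (A x) x) / (norm x)\<^sup>2 \<le> m"
        by (metis Re_divide_of_real times_divide_eq_right)
      then show ?thesis
        using False by (simp add: Q_def inner_simps HA power2_norm_eq_inner[symmetric] divide_le_eq)
    qed simp
    fix \<epsilon> :: real assume "\<epsilon> > 0"
    then have "m - \<epsilon> < Sup V" by (simp add: m_def)
    then obtain w where w: "w \<in> numerical_range A" "m - \<epsilon> < Re (d * w)"
      using less_cSup_iff[OF _ bdd, of "m - \<epsilon>"] ne by (auto simp: V_def)
    then obtain x where x: "norm x = 1" "w = cinner (A x) x" by (auto simp: numerical_range_def)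
    have "inner x x = 1" using x(1) by (simp add: norm_eq_1)
    then show "\<exists>x. norm x = 1 \<and> inner (Q x) x \<le> \<epsilon>"
      using x w by (intro exI[of _ x]) (simp add: Q_def inner_diff_left HA)
  qed
  then obtain k where k: "\<And>\<epsilon>. \<epsilon> > 0 \<Longrightarrow> \<exists>y. norm y = 1 \<and> norm (Q y) \<le> \<epsilon> \<and> norm (K y - k *\<^sub>R y) \<le> \<epsilon>"
    by blast
  define s where "s = Complex m k / d"
  have ds: "d * s = Complex m k" using d by (simp add: s_def)
  show ?thesis
  proof (rule that[of s])
    show "Re (d * w) \<le> Re (d * s)" if "w \<in> numerical_range A" for w
      using Vm[OF that] by (simp only: ds complex.sel)
    show "s \<in> spectrum A"
      unfolding normal_op_spectrum_iff[OF A]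
    proof (intro allI impI)
      fix \<epsilon> :: real assume "\<epsilon> > 0"
      then have "cmod d * \<epsilon> / 2 > 0" using d by simp
      from k[OF this] obtain y where y: "norm y = 1" "norm (Q y) \<le> cmod d * \<epsilon> / 2"
        "norm (K y - k *\<^sub>R y) \<le> cmod d * \<epsilon> / 2" by blast
      have "Complex m k *\<^sub>C y = m *\<^sub>R y + \<i> *\<^sub>C (k *\<^sub>R y)"
        unfolding scaleC_of_real[symmetric] scaleC_scaleC scaleC_left_distrib[symmetric]
        by (simp add: complex_eq_iff Complex_eq)
      then have "d *\<^sub>C (A y - s *\<^sub>C y) = \<i> *\<^sub>C (K y - k *\<^sub>R y) - Q y"
        by (simp add: scaleC_diff_right scaleC_scaleC ds dA Q_def)
      then have "cmod d * norm (A y - s *\<^sub>C y) = norm (\<i> *\<^sub>C (K y - k *\<^sub>R y) - Q y)"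
        by (metis norm_scaleC)
      also have "\<dots> \<le> norm (\<i> *\<^sub>C (K y - k *\<^sub>R y)) + norm (Q y)" by (rule norm_triangle_ineq4)
      also have "\<dots> \<le> cmod d * \<epsilon>" using y by (simp add: norm_scaleC)
      finally show "\<exists>x. norm x = 1 \<and> norm (A x - s *\<^sub>C x) \<le> \<epsilon>" using y(1) d by auto
    qed
  qed
qed

lemma normal_op_spectrum_nonempty:
  assumes A: "normal_op A" and ne: "numerical_range A \<noteq> {}"
  shows "spectrum A \<noteq> {}"
  using normal_op_spectrum_support[OF A ne, of 1] by auto

text \<open>The hull of the compact spectrum is closed; a functional separating \<open>w\<close>
  from it would contradict \<open>normal_op_spectrum_support\<close>.\<close>

lemma normal_op_numerical_range_subset:
  assumes A: "normal_op A"
  shows "numerical_range A \<subseteq> convex hull (spectrum A)"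
proof
  fix w assume w: "w \<in> numerical_range A"
  then have ne: "numerical_range A \<noteq> {}" by auto
  show "w \<in> convex hull (spectrum A)"
  proof (rule ccontr)
    assume "w \<notin> convex hull (spectrum A)"
    moreover have "closed (convex hull (spectrum A))"
      by (intro compact_imp_closed compact_convex_hull normal_op_compact_spectrum A)
    ultimately obtain a c where a: "inner a w < c" "\<And>x. x \<in> convex hull (spectrum A) \<Longrightarrow> inner a x > c"
      using separating_hyperplane_closed_point[OF convex_convex_hull] by blast
    obtain s0 where "s0 \<in> spectrum A" using normal_op_spectrum_nonempty[OF A ne] by auto
    then have "inner a s0 > c" by (intro a hull_inc)
    then have "- cnj a \<noteq> 0" using a(1) by auto
    then obtain s where s: "s \<in> spectrum A" "Re (- cnj a * w) \<le> Re (- cnj a * s)"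
      using normal_op_spectrum_support[OF A ne] w by metis
    have "inner a s > c" by (intro a hull_inc s)
    moreover have "inner a s \<le> inner a w" using s(2) by (simp add: inner_complex_def)
    ultimately show False using a(1) by simp
  qed
qed

section \<open>Polygonal numerical ranges\<close>

text \<open>A vertex can be strictly separated from the finitely many other points, so the polygon
  lies in a sector at \<open>l\<close>, and the corner lemma applies.\<close>

lemma polygon_vertex_reducing_approx_eigenvalue:
  assumes A: "bounded_op A" and cl: "closure (numerical_range A) = convex hull S" and fin: "finite S"
    and l: "l extreme_point_of (convex hull S)" and lS: "l \<in> S"
  shows "reducing_approx_eigenvalue A l"
proof -
  have "\<exists>d. d \<noteq> 0 \<and> (\<forall>w\<in>S - {l}. Re (d * (l - w)) > 0)"
  proof (cases "S - {l} = {}")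
    case True
    show ?thesis unfolding True by (rule exI[of _ 1]) auto
  next
    case False
    then obtain w0 where w0: "w0 \<in> S - {l}" by blast
    have "convex (convex hull S - {l})"
      using l extreme_point_of_stillconvex[OF convex_convex_hull] by blast
    then have "convex hull (S - {l}) \<subseteq> convex hull S - {l}"
      by (intro hull_minimal) (auto intro: hull_inc)
    then have "l \<notin> convex hull (S - {l})" by auto
    moreover have "closed (convex hull (S - {l}))"
      using fin by (intro compact_imp_closed compact_convex_hull finite_imp_compact) auto
    ultimately obtain a b where a: "inner a l < b" "\<And>x. x \<in> convex hull (S - {l}) \<Longrightarrow> inner a x > b"
      using separating_hyperplane_closed_point[OF convex_convex_hull] by blast
    have pos: "Re (- cnj a * (l - w)) > 0" if "w \<in> S - {l}" for w
    proof -
      have "inner a w > b" by (intro a hull_inc that)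
      then show ?thesis using a(1) by (simp add: inner_complex_def algebra_simps)
    qed
    have "- cnj a \<noteq> 0" using pos[OF w0] by auto
    then show ?thesis using pos by blast
  qed
  then obtain d where d: "d \<noteq> 0" "\<And>w. w \<in> S - {l} \<Longrightarrow> Re (d * (l - w)) > 0" by blast
  \<comment> \<open>The summand 1 keeps the quotient defined when the imaginary part vanishes;
    inserting 1 into the minimum covers \<open>S = {l}\<close>.\<close>
  define f where "f = (\<lambda>w. Re (d * (l - w)) / (1 + \<bar>Im (d * (l - w))\<bar>))"
  define \<tau> where "\<tau> = Min (insert 1 (f ` (S - {l})))"
  have tau: "\<tau> > 0"
    unfolding \<tau>_def using fin d(2) by (subst Min_gr_iff) (auto simp: f_def intro!: divide_pos_pos)
  have tauS: "\<tau> * \<bar>Im (d * (l - w))\<bar> \<le> Re (d * (l - w))" if "w \<in> S" for w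
  proof (cases "w = l")
    case False
    have "\<tau> \<le> f w" unfolding \<tau>_def using fin that False by (intro Min_le) auto
    then have "\<tau> * (1 + \<bar>Im (d * (l - w))\<bar>) \<le> Re (d * (l - w))"
      unfolding f_def by (simp only: pos_le_divide_eq add_pos_nonneg zero_less_one abs_ge_zero)
    then show ?thesis using tau unfolding distrib_left by linarith
  qed simp
  \<comment> \<open>The sector is the intersection of the half-planes tilted by
    \<open>\<tau>\<close> and \<open>- \<tau>\<close>; their convexity extends the sector condition
    from \<open>S\<close> to its hull.\<close>
  define H where "H = (\<lambda>s. {w. Re (((1 + of_real s * \<i>) * d) * w) \<le> Re (((1 + of_real s * \<i>) * d) * l)})"
  have H_iff: "w \<in> H s \<longleftrightarrow> s * Im (d * (l - w)) \<le> Re (d * (l - w))" for w s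
    by (simp add: H_def algebra_simps)
  have cH: "convex (H s)" for s unfolding H_def by (rule convex_Re_mult_le)
  have "S \<subseteq> H \<tau> \<inter> H (- \<tau>)"
  proof
    fix w assume "w \<in> S"
    have "\<bar>\<tau> * Im (d * (l - w))\<bar> \<le> Re (d * (l - w))"
      using tauS[OF \<open>w \<in> S\<close>] tau by (simp only: abs_mult abs_of_pos)
    then show "w \<in> H \<tau> \<inter> H (- \<tau>)" unfolding Int_iff H_iff mult_minus_left by linarith
  qed
  then have hull: "convex hull S \<subseteq> H \<tau> \<inter> H (- \<tau>)"
    by (intro hull_minimal convex_Int cH)
  show ?thesis
  proof (rule corner_reducing_approx_eigenvalue[OF A _ d(1) tau])
    show "l \<in> closure (numerical_range A)" unfolding cl using lS by (rule hull_inc)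
    fix w assume "w \<in> numerical_range A"
    then have "w \<in> H \<tau> \<inter> H (- \<tau>)" using hull closure_subset cl by blast
    then have "\<bar>\<tau> * Im (d * (l - w))\<bar> \<le> Re (d * (l - w))"
      unfolding Int_iff H_iff mult_minus_left by linarith
    then show "\<tau> * \<bar>Im (d * (l - w))\<bar> \<le> Re (d * (l - w))"
      using tau by (simp only: abs_mult abs_of_pos)
  qed
qed

text \<open>\<open>F\<close> may contain points that are not vertices and to which the corner
  argument does not apply, so \<open>S\<close> is taken to be the set of extreme points.\<close>

lemma polygon_rank_one_condition_imp_multiple_psd:
  assumes A: "bounded_op A" and star: "rank_one_condition A"
    and poly: "convex_polygon (closure (numerical_range A))"
  shows "\<exists>\<gamma> P. psd_op P \<and> A = (\<lambda>x. \<gamma> *\<^sub>C P x)"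
proof -
  obtain F where F: "finite F" "F \<noteq> {}" "closure (numerical_range A) = convex hull F"
    using poly by (auto simp: convex_polygon_def)
  define S where "S = {x. x extreme_point_of (convex hull F)}"
  have fin: "finite S"
    using F(1) extreme_point_of_convex_hull by (auto simp: S_def intro: finite_subset[of _ F])
  have FS: "convex hull F = convex hull S"
    unfolding S_def using F(1)
    by (intro Krein_Milman_Minkowski compact_convex_hull finite_imp_compact convex_convex_hull)
  have "S \<noteq> {}" using FS F(2) by (metis convex_hull_eq_empty)
  then have "Max (cmod ` S) \<in> cmod ` S" using fin by (intro Max_in) auto
  then obtain l where l: "l \<in> S" "cmod l = Max (cmod ` S)" by auto
  show ?thesis
  proof (rule rank_one_condition_imp_multiple_psd[OF A star _ l(1)])
    show "numerical_range A \<subseteq> convex hull S"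
      unfolding FS[symmetric] F(3)[symmetric] by (rule closure_subset)
    show "cmod a \<le> cmod l" if "a \<in> S" for a unfolding l(2) using fin that by (intro Max_ge) auto
    show "reducing_approx_eigenvalue A a" if "a \<in> S" for a
    proof (rule polygon_vertex_reducing_approx_eigenvalue[OF A _ fin _ that])
      show "closure (numerical_range A) = convex hull S" by (simp only: F(3) FS)
      have "a extreme_point_of convex hull F" using that by (simp add: S_def)
      then show "a extreme_point_of convex hull S" by (simp only: FS)
    qed
    show "closed (S - {l})" using fin by (intro finite_imp_closed) auto
  qed
qed

lemma isolated_rank_one_condition_imp_multiple_psd:
  assumes A: "normal_op A" and star: "rank_one_condition A"
    and l: "l isolated_in spectrum A" "cmod l = spectral_radius A"
  shows "\<exists>\<gamma> P. psd_op P \<and> A = (\<lambda>x. \<gamma> *\<^sub>C P x)"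
proof (rule rank_one_condition_imp_multiple_psd[OF _ star normal_op_numerical_range_subset[OF A]])
  note comp = normal_op_compact_spectrum[OF A]
  show "bounded_op A" using A by (simp add: normal_op_def)
  obtain T where T: "open T" "T \<inter> spectrum A = {l}" using l(1) by (auto simp: isolated_in_def)
  then show "l \<in> spectrum A" by blast
  have "spectrum A - {l} = spectrum A - T" using T(2) by blast
  then show "closed (spectrum A - {l})" using T(1) compact_imp_closed[OF comp] by (simp add: closed_Diff)
  have "bdd_above (cmod ` spectrum A)"
    using compact_imp_bounded[OF comp] by (auto simp: bounded_iff bdd_above_def)
  then show "cmod a \<le> cmod l" if "a \<in> spectrum A" for a
    unfolding l(2) spectral_radius_def using that by (intro cSup_upper) auto
qed (rule normal_op_reducing_approx_eigenvalue[OF A])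

text \<open>The zero space has no unit vectors, so there the numerical range is empty and is not a
  polygon.\<close>

lemma numerical_range_nonempty: "\<exists>x::'a::complex_hilbert. x \<noteq> 0 \<Longrightarrow> numerical_range (A :: 'a \<Rightarrow> 'a) \<noteq> {}"
proof -
  assume "\<exists>x::'a. x \<noteq> 0"
  then obtain x :: 'a where "x \<noteq> 0" by blast
  then have "norm ((1 / norm x) *\<^sub>R x) = 1" by simp
  from numerical_range_memI[OF this, of A] show ?thesis by auto
qed

lemma normal_op_finite_spectrum_polygon:
  assumes A: "normal_op A" and fin: "finite (spectrum A)" and ne: "\<exists>x::'a::complex_hilbert. x \<noteq> 0"
  shows "convex_polygon (closure (numerical_range (A :: 'a \<Rightarrow> 'a)))"
  unfolding convex_polygon_def
proof (intro exI conjI)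
  have b: "bounded_op A" using A by (simp add: normal_op_def)
  show "closure (numerical_range A) = convex hull (spectrum A)"
  proof
    show "closure (numerical_range A) \<subseteq> convex hull (spectrum A)"
      by (intro closure_minimal normal_op_numerical_range_subset[OF A] compact_imp_closed
          compact_convex_hull normal_op_compact_spectrum[OF A])
    show "convex hull (spectrum A) \<subseteq> closure (numerical_range A)"
      by (intro hull_minimal normal_op_spectrum_subset_closure[OF A] convex_closure toeplitz_hausdorff[OF b])
  qed
  show "spectrum A \<noteq> {}" by (rule normal_op_spectrum_nonempty[OF A numerical_range_nonempty[OF ne]])
qed (rule fin)

text \<open>By convexity and boundedness the real values of the form of \<open>T\<close> have a
  compact interval as closure, which multiplication by \<open>\<gamma>\<close> maps to a segment or
  a point.\<close>

lemma hermitian_multiple_polygon: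
  assumes T: "hermitian_op T" and ne: "\<exists>x::'a::complex_hilbert. x \<noteq> 0"
  shows "convex_polygon (closure (numerical_range (\<lambda>x::'a. \<gamma> *\<^sub>C T x)))"
proof -
  have b: "bounded_op T" using T by (simp add: hermitian_op_def)
  have real: "cinner (T x) x = of_real (Re (cinner (T x) x))" for x
  proof -
    have "cinner (T x) x = cinner x (T x)"
      using cadjoint[OF b, of x x] T by (simp add: hermitian_op_def)
    then have "cinner (T x) x = cnj (cinner (T x) x)" by (metis cinner_commute)
    then show ?thesis by (simp add: complex_eq_iff)
  qed
  define V where "V = Re ` numerical_range T"
  define h where "h = (\<lambda>r. \<gamma> * complex_of_real r)"
  have lin: "bounded_linear h"
    unfolding h_def by (intro bounded_linear_const_mult bounded_linear_of_real)
  have "numerical_range (\<lambda>x. \<gamma> *\<^sub>C T x) = (*) \<gamma> ` numerical_range T"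
    by (auto simp: numerical_range_def cinner_simps)
  also have "\<dots> = h ` V"
    unfolding V_def h_def image_image
    by (rule image_cong) (use real in \<open>auto simp: numerical_range_def\<close>)
  finally have W: "numerical_range (\<lambda>x. \<gamma> *\<^sub>C T x) = h ` V" .
  have bV: "bounded V"
    unfolding V_def by (intro bounded_linear_image[OF bounded_numerical_range[OF b]] bounded_linear_Re)
  then have comp: "compact (closure V)" by simp
  have "convex V"
    unfolding V_def by (intro convex_linear_image toeplitz_hausdorff[OF b] bounded_linear.linear bounded_linear_Re)
  then have "connected (closure V)" by (intro convex_connected convex_closure)
  then obtain p q where pq: "closure V = {p..q}"
    using comp connected_compact_interval_1 by blast
  have "V \<noteq> {}" using numerical_range_nonempty[OF ne, of T] by (simp add: V_def)
  then have "p \<le> q" using pq by (metis atLeastatMost_empty_iff closure_eq_empty)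
  then have "closure V = convex hull {p, q}"
    unfolding pq by (simp add: segment_convex_hull[symmetric] closed_segment_eq_real_ivl)
  then have "h ` closure V = convex hull (h ` {p, q})"
    using convex_hull_linear_image[OF bounded_linear.linear[OF lin]] by metis
  moreover have "closure (h ` V) = h ` closure V"
  proof
    show "closure (h ` V) \<subseteq> h ` closure V"
      by (intro closure_minimal image_mono closure_subset compact_imp_closed compact_continuous_image
          linear_continuous_on lin comp)
    show "h ` closure V \<subseteq> closure (h ` V)" by (rule closure_bounded_linear_image_subset[OF lin])
  qed
  ultimately show ?thesis
    unfolding W convex_polygon_def by (intro exI[of _ "h ` {p, q}"]) auto
qed

theorem corollary1p6:
  fixes A :: "'a::complex_hilbert \<Rightarrow> 'a"
  assumes "bounded_op A"
  shows
    "let A1 = (\<exists>\<gamma> P. psd_op P \<and> A = (\<lambda>x. \<gamma> *\<^sub>C P x));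
         A2 = (\<forall>B. bounded_op B \<longrightarrow>
                 spectrum (A \<circ> B) \<subseteq> closure (numerical_range A * numerical_range B));
         A3 = (\<forall>B. rank_one_op B \<longrightarrow>
                 spectrum (A \<circ> B) \<subseteq> closure (numerical_range A * numerical_range B))
     in
       (convex_polygon (closure (numerical_range A)) \<longrightarrow> (A1 \<longleftrightarrow> A2) \<and> (A2 \<longleftrightarrow> A3)) \<and>
       ((\<exists>x::'a. x \<noteq> 0) \<and>
          ((\<exists>\<gamma> T. hermitian_op T \<and> A = (\<lambda>x. \<gamma> *\<^sub>C T x)) \<or>
           (normal_op A \<and> finite (spectrum A)))
        \<longrightarrow> convex_polygon (closure (numerical_range A))) \<and>
       (normal_op A \<and>
          (\<exists>z. z isolated_in spectrum A \<and> cmod z = spectral_radius A)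
        \<longrightarrow> (A1 \<longleftrightarrow> A2) \<and> (A2 \<longleftrightarrow> A3))"
proof -
  define A1 where "A1 \<longleftrightarrow> (\<exists>\<gamma> P. psd_op P \<and> A = (\<lambda>x. \<gamma> *\<^sub>C P x))"
  define A2 where "A2 \<longleftrightarrow> (\<forall>B. bounded_op B \<longrightarrow>
    spectrum (A \<circ> B) \<subseteq> closure (numerical_range A * numerical_range B))"
  define A3 where "A3 \<longleftrightarrow> (\<forall>B. rank_one_op B \<longrightarrow>
    spectrum (A \<circ> B) \<subseteq> closure (numerical_range A * numerical_range B))"
  \<comment> \<open>The equivalences follow from a cycle, closed in each case by its own implication
    from \<open>A3\<close> back to \<open>A1\<close>.\<close>
  have 12: "A1 \<Longrightarrow> A2"
    unfolding A1_def A2_def using spectrum_multiple_psd_comp_subset by blast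
  have 23: "A2 \<Longrightarrow> A3"
    unfolding A2_def A3_def rank_one_op_def by blast
  have star: "A3 \<Longrightarrow> rank_one_condition A"
    unfolding A3_def by (intro rank_one_conditionI assms) blast
  have poly: "A1" if "A3" "convex_polygon (closure (numerical_range A))"
    unfolding A1_def by (rule polygon_rank_one_condition_imp_multiple_psd[OF assms star[OF that(1)] that(2)])
  have isol: "A1" if "A3" "normal_op A" "z isolated_in spectrum A" "cmod z = spectral_radius A" for z
    unfolding A1_def by (rule isolated_rank_one_condition_imp_multiple_psd[OF that(2) star[OF that(1)] that(3,4)])
  show ?thesis
    unfolding Let_def A1_def[symmetric] A2_def[symmetric] A3_def[symmetric]
    using 12 23 poly isol hermitian_multiple_polygon normal_op_finite_spectrum_polygon by blast
qed

end
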